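(* Let $S=\mathbb{A}^2_{\mathbb{C}}=\operatorname{Spec}R$ with $R=\mathbb{C}[x,y]$. Let $(I,p)\in\mathcal{Z}_{n+1}$, so that $I\subset R$ has colength $n+1$ and $p\in\operatorname{Supp}(R/I)$. Then the fibre of $$\rho:S^{[n,n+1]}\longrightarrow\mathcal{Z}_{n+1},\qquad \rho(I\subset J)=(I,\operatorname{res}(I,J)),$$ over $(I,p)$ is naturally identified with $$\rho^{-1}(I,p)\cong\mathbb{P}(\operatorname{Soc}_p(R/I)),$$ where $\mathbb{P}(V)$ denotes the projective space of lines in the vector space $V$.
   Context: All schemes are over $\mathbb{C}$. $S^{[n]}=\operatorname{Hilb}^n(S)$ is the Hilbert scheme of $n$ points; its closed points are ideals of $R$ of colength $n$. The nested Hilbert scheme $S^{[n,n+1]}\subset S^{[n+1]}\times S^{[n]}$ is the closed incidence subscheme of pairs $(Z,Y)$ with $Y\subset Z$; its closed points are pairs of ideals $I\subset J\subset R$ with $\dim_{\mathbb{C}}R/I=n+1$, $\dim_{\mathbb{C}}R/J=n$. For such a pair, $J/I$ is an $R$-module of length one, so $J/I\cong R/\mathfrak{m}_p$ for a unique closed point $p\in S$ with maximal ideal $\mathfrak{m}_p$; this $p$ is the residual point $\operatorname{res}(I,J)$. (In families over a base $B$, the quotient of the two ideal sheaves is an invertible $\mathcal{O}_B$-module on which $R$ acts through a ring map $R\to\mathcal{O}_B(B)$, giving the residual morphism $B\to S$.) $\mathcal{Z}_{n+1}\subset S^{[n+1]}\times S$ is the universal family, whose closed points are pairs $(I,p)$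 with $I$ of colength $n+1$ and $p\in\operatorname{Supp}(R/I)$. The local socle of $R/I$ at $p$ is $\operatorname{Soc}_p(R/I)=\{\bar f\in R/I:\mathfrak{m}_p\bar f=0\}$. *)

theory Defs
  imports Complex_Main "HOL-Computational_Algebra.Polynomial" "HOL-Library.Poly_Mapping"
begin

text \<open>
  Schemes over the complex numbers are handled through their functors of points on commutative
  \<open>\<complex>\<close>-algebras: such an algebra is a type \<open>'b\<close> of class \<open>comm_ring_1\<close> with a unital ring
  homomorphism \<open>\<iota> :: complex \<Rightarrow> 'b\<close>. (The class excludes only the zero ring, over which every
  scheme has exactly one point.) By Yoneda, an isomorphism of schemes is a bijection on
  \<open>'b\<close>-points for every \<open>'b\<close>, natural in \<open>'b\<close>.
\<close>

definition unital_ring_hom :: "('a::comm_ring_1 \<Rightarrow> 'b::comm_ring_1) \<Rightarrow> bool" where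
  "unital_ring_hom \<phi> \<longleftrightarrow> \<phi> 1 = 1 \<and> (\<forall>a b. \<phi> (a + b) = \<phi> a + \<phi> b) \<and> (\<forall>a b. \<phi> (a * b) = \<phi> a * \<phi> b)"


subsection \<open>Free and locally free quotients\<close>

text \<open>
  Quotient modules \<open>M / N\<close> are represented by the pair of submodules \<open>N \<subseteq> M\<close> of an ambient module
  with scalar multiplication \<open>s\<close>. The predicate below says that \<open>e 0, \<dots>, e (r - 1) \<in> M\<close> induce a
  basis of the localisation \<open>(M / N)\<^sub>f\<close> over \<open>B\<^sub>f\<close>, where \<open>f\<close> is a scalar: an element \<open>m\<close> of \<open>M / N\<close> becomes
  \<open>0\<close> in the localisation iff some \<open>f ^ k\<close> kills it, and every basis of \<open>(M / N)\<^sub>f\<close> can be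
  multiplied by a power of \<open>f\<close> so as to come from \<open>M\<close>. For \<open>f = 1\<close> this is a basis of \<open>M / N\<close>.
\<close>

definition basis_away ::
  "('b::comm_ring_1 \<Rightarrow> 'm::ab_group_add \<Rightarrow> 'm) \<Rightarrow> 'b \<Rightarrow> 'm set \<Rightarrow> 'm set \<Rightarrow> nat \<Rightarrow> (nat \<Rightarrow> 'm) \<Rightarrow> bool" where
  "basis_away s f M N r e \<longleftrightarrow>
     (\<forall>i<r. e i \<in> M) \<and>
     (\<forall>m\<in>M. \<exists>k b. s (f ^ k) m - (\<Sum>i<r. s (b i) (e i)) \<in> N) \<and>
     (\<forall>b. (\<Sum>i<r. s (b i) (e i)) \<in> N \<longrightarrow> (\<forall>i<r. \<exists>k. f ^ k * b i = 0))"

definition free_quot ::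
  "('b::comm_ring_1 \<Rightarrow> 'm::ab_group_add \<Rightarrow> 'm) \<Rightarrow> 'm set \<Rightarrow> 'm set \<Rightarrow> nat \<Rightarrow> bool" where
  "free_quot s M N r \<longleftrightarrow> (\<exists>e. basis_away s 1 M N r e)"

definition locally_free_quot ::
  "('b::comm_ring_1 \<Rightarrow> 'm::ab_group_add \<Rightarrow> 'm) \<Rightarrow> 'm set \<Rightarrow> 'm set \<Rightarrow> nat \<Rightarrow> bool" where
  "locally_free_quot s M N r \<longleftrightarrow>
     (\<exists>F. finite F \<and> 1 \<in> module.span (*) F \<and> (\<forall>f\<in>F. \<exists>e. basis_away s f M N r e))"


subsection \<open>The affine plane\<close>

text \<open>
  \<open>'b poly poly\<close> is \<open>B[x][y] = R \<otimes> B\<close>. A \<open>'b\<close>-point of the affine plane is a pair \<open>(a, b)\<close>,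
  i.e. the \<open>\<complex>\<close>-algebra map \<open>R \<rightarrow> B\<close>, or \<open>B\<close>-algebra map \<open>B[x,y] \<rightarrow> B\<close>, with \<open>x \<mapsto> a\<close>, \<open>y \<mapsto> b\<close>.
\<close>

definition eval2 :: "'b::comm_ring_1 \<times> 'b \<Rightarrow> 'b poly poly \<Rightarrow> 'b" where
  "eval2 q g = poly (poly g [:snd q:]) (fst q)"

definition pscale :: "'b::comm_ring_1 \<Rightarrow> 'b poly poly \<Rightarrow> 'b poly poly" where
  "pscale b g = smult [:b:] g"

definition base_change :: "('a::comm_ring_1 \<Rightarrow> 'b::comm_ring_1) \<Rightarrow> 'a poly poly \<Rightarrow> 'b poly poly" where
  "base_change \<phi> = map_poly (map_poly \<phi>)"

definition pull_ideal ::
  "('a::comm_ring_1 \<Rightarrow> 'b::comm_ring_1) \<Rightarrow> 'a poly poly set \<Rightarrow> 'b poly poly set" where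
  "pull_ideal \<phi> J = module.span (*) (base_change \<phi> ` J)"

definition max_ideal :: "complex \<times> complex \<Rightarrow> complex poly poly set" where
  "max_ideal p = {g. eval2 p g = 0}"

text \<open>\<open>p\<close> lies in the support of \<open>R / I\<close> iff some \<open>h / 1\<close> is nonzero in the localisation of
  \<open>R / I\<close> at \<open>max_ideal p\<close>.\<close>

definition Supp_quot :: "complex poly poly set \<Rightarrow> (complex \<times> complex) set" where
  "Supp_quot I = {p. \<exists>h. \<forall>t. t \<notin> max_ideal p \<longrightarrow> t * h \<notin> I}"

text \<open>The numerators of the local socle: \<open>Soc\<^sub>p(R / I)\<close> is \<open>soc_num I p / I\<close>.\<close>

definition soc_num :: "complex poly poly set \<Rightarrow> complex \<times> complex \<Rightarrow> complex poly poly set" where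
  "soc_num I p = {h. \<forall>g\<in>max_ideal p. g * h \<in> I}"


subsection \<open>Hilbert schemes, universal family, residual point\<close>

text \<open>Families of closed subschemes of the plane, flat and finite of degree \<open>n\<close> over the base.\<close>

definition hilb :: "nat \<Rightarrow> 'b::comm_ring_1 poly poly set set" where
  "hilb n = {I. module.subspace (*) I \<and> locally_free_quot pscale UNIV I n}"

definition nested_hilb :: "nat \<Rightarrow> ('b::comm_ring_1 poly poly set \<times> 'b poly poly set) set" where
  "nested_hilb n = {(I, J). I \<in> hilb (Suc n) \<and> J \<in> hilb n \<and> I \<subseteq> J}"

text \<open>\<open>(I, q)\<close> is a point of the universal family iff \<open>q\<close> factors through the closed subscheme
  defined by \<open>I\<close>.\<close>

definition univ_family :: "nat \<Rightarrow> ('b::comm_ring_1 poly poly set \<times> ('b \<times> 'b)) set" where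
  "univ_family n = {(I, q). I \<in> hilb n \<and> (\<forall>f\<in>I. eval2 q f = 0)}"

lemma module_times: "module ((*) :: 'a::comm_ring_1 \<Rightarrow> 'a \<Rightarrow> 'a)"
  by unfold_locales (simp_all add: algebra_simps)

lemma pscale_eq_times: "pscale b g = [:[:b:]:] * g"
  by (simp add: pscale_def)

lemma module_pscale: "module (pscale :: 'a::comm_ring_1 \<Rightarrow> _)"
proof
  fix a b :: 'a and g h :: "'a poly poly"
  show "pscale a (g + h) = pscale a g + pscale a h" by (simp add: pscale_def smult_add_right)
  have "[:a + b:] = [:a:] + [:b:]" by simp
  then show "pscale (a + b) g = pscale a g + pscale b g"
    unfolding pscale_def by (simp only: smult_add_left)
  show "pscale a (pscale b g) = pscale (a * b) g" by (simp add: pscale_def mult.commute)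
  show "pscale 1 g = g" by (simp add: pscale_def one_pCons[symmetric])
qed

lemma locally_free_quot_complex_iff:
  fixes I :: "complex poly poly set"
  assumes "module.subspace (*) I"
  shows "locally_free_quot pscale UNIV I n \<longleftrightarrow> free_quot pscale UNIV I n"
proof
  assume "free_quot pscale UNIV I n"
  then obtain e where "basis_away pscale (1::complex) UNIV I n e"
    by (auto simp: free_quot_def)
  moreover have "(1::complex) \<in> module.span (*) {1}"
    by (rule module.span_base[OF module_times]) simp
  ultimately show "locally_free_quot pscale UNIV I n"
    unfolding locally_free_quot_def by (intro exI[of _ "{1}"]) auto
next
  assume "locally_free_quot pscale UNIV I n"
  then obtain F where F: "1 \<in> module.span (*) F"
    "\<forall>f\<in>F. \<exists>e. basis_away pscale (f::complex) UNIV I n e"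
    by (auto simp: locally_free_quot_def)
  have "\<exists>f\<in>F. f \<noteq> 0"
  proof (rule ccontr)
    assume "\<not> (\<exists>f\<in>F. f \<noteq> 0)"
    then have "F \<subseteq> {0}" by auto
    then have "module.span (*) F \<subseteq> {0}"
      by (rule module.span_minimal[OF module_times]) (rule module.subspace_single_0[OF module_times])
    with F(1) show False by auto
  qed
  with F(2) obtain f e where f: "f \<noteq> 0" and e: "basis_away pscale f UNIV I n e" by auto
  have "basis_away pscale 1 UNIV I n e"
    unfolding basis_away_def
  proof (intro conjI allI impI ballI)
    fix i show "e i \<in> UNIV" by simp
  next
    fix m :: "complex poly poly"
    from e obtain k b where kb: "pscale (f ^ k) m - (\<Sum>i<n. pscale (b i) (e i)) \<in> I"
      unfolding basis_away_def by blast
    let ?c = "inverse (f ^ k)"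
    have "pscale ?c (pscale (f ^ k) m - (\<Sum>i<n. pscale (b i) (e i))) \<in> I"
      unfolding pscale_eq_times[of ?c] by (rule module.subspace_scale[OF module_times assms kb])
    moreover have "pscale ?c (pscale (f ^ k) m - (\<Sum>i<n. pscale (b i) (e i)))
        = pscale (1 ^ 0) m - (\<Sum>i<n. pscale (?c * b i) (e i))"
      using f by (simp add: module.scale_right_diff_distrib[OF module_pscale]
          module.scale_sum_right[OF module_pscale] module.scale_scale[OF module_pscale]
          module.scale_one[OF module_pscale])
    ultimately show "\<exists>k b. pscale (1 ^ k) m - (\<Sum>i<n. pscale (b i) (e i)) \<in> I"
      by metis
  next
    fix b i assume "(\<Sum>i<n. pscale (b i) (e i)) \<in> I" and "i < n"
    with e obtain k where "f ^ k * b i = 0" unfolding basis_away_def by blast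
    with f show "\<exists>k. 1 ^ k * b i = 0" by auto
  qed
  then show "free_quot pscale UNIV I n" by (auto simp: free_quot_def)
qed

text \<open>The closed points of the universal family are the pairs \<open>(I, p)\<close> with \<open>I\<close> an ideal of
  colength \<open>n\<close> and \<open>p\<close> in the support of \<open>R / I\<close>.\<close>

lemma univ_family_complex_iff:
  fixes I :: "complex poly poly set"
  shows "(I, p) \<in> univ_family n \<longleftrightarrow>
           module.subspace (*) I \<and> free_quot pscale UNIV I n \<and> p \<in> Supp_quot I"
proof -
  have "(\<forall>f\<in>I. eval2 p f = 0) \<longleftrightarrow> p \<in> Supp_quot I" if I: "module.subspace (*) I"
  proof
    assume "\<forall>f\<in>I. eval2 p f = 0"
    then show "p \<in> Supp_quot I"
      unfolding Supp_quot_def max_ideal_def by (auto intro: exI[of _ 1])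
  next
    assume "p \<in> Supp_quot I"
    then obtain h where h: "\<And>t. t \<notin> max_ideal p \<Longrightarrow> t * h \<notin> I" by (auto simp: Supp_quot_def)
    show "\<forall>f\<in>I. eval2 p f = 0"
    proof (rule ballI, rule ccontr)
      fix f assume "f \<in> I" and "eval2 p f \<noteq> 0"
      with h[of f] have "f * h \<notin> I" by (auto simp: max_ideal_def)
      with module.subspace_scale[OF module_times I \<open>f \<in> I\<close>, of h] show False
        by (simp add: mult.commute)
    qed
  qed
  then show ?thesis
    using locally_free_quot_complex_iff[of I n] by (auto simp: univ_family_def hilb_def)
qed

text \<open>The residual morphism: the point \<open>q\<close> through which \<open>B[x,y]\<close> acts on \<open>J / I\<close>. It exists and
  is unique for points \<open>(I, J)\<close> of the nested Hilbert scheme, \<open>J / I\<close> being invertible there.\<close>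

definition res :: "'b::comm_ring_1 poly poly set \<Rightarrow> 'b poly poly set \<Rightarrow> 'b \<times> 'b" where
  "res I J = (THE q. \<forall>g. \<forall>j\<in>J. g * j - pscale (eval2 q g) j \<in> I)"

definition rho :: "'b::comm_ring_1 poly poly set \<times> 'b poly poly set \<Rightarrow> 'b poly poly set \<times> ('b \<times> 'b)" where
  "rho = (\<lambda>(I, J). (I, res I J))"

text \<open>
  The \<open>'b\<close>-points of the scheme-theoretic fibre of \<open>rho\<close> over the closed point \<open>(I, p)\<close>: the
  points of the nested Hilbert scheme which \<open>rho\<close> sends to the pullback of \<open>(I, p)\<close> to \<open>'b\<close>.
  The universal family is a closed subscheme of \<open>hilb (Suc n) \<times> S\<close>, so it is enough to compare
  points of the latter.
\<close>

definition fibre_rho ::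
  "(complex \<Rightarrow> 'b::comm_ring_1) \<Rightarrow> nat \<Rightarrow> complex poly poly set \<Rightarrow> complex \<times> complex
     \<Rightarrow> ('b poly poly set \<times> 'b poly poly set) set" where
  "fibre_rho \<iota> n I p = {z \<in> nested_hilb n. rho z = (pull_ideal \<iota> I, map_prod \<iota> \<iota> p)}"


subsection \<open>Projective space of lines\<close>

text \<open>
  Let \<open>V = E / K\<close> be a complex vector space, with \<open>K \<subseteq> E\<close> subspaces for the scalar multiplication
  \<open>sc\<close>. The tensor product \<open>V \<otimes> B\<close> is the free \<open>B\<close>-module \<open>free_on E\<close> on the set \<open>E\<close> modulo
  the submodule \<open>tensor_rel \<iota> sc E K\<close>; the generator \<open>single v b\<close> represents \<open>v \<otimes> b\<close>.
\<close>

definition fscale :: "'b::comm_ring_1 \<Rightarrow> ('v \<Rightarrow>\<^sub>0 'b) \<Rightarrow> ('v \<Rightarrow>\<^sub>0 'b)" where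
  "fscale b = Poly_Mapping.map ((*) b)"

definition free_on :: "'v set \<Rightarrow> ('v \<Rightarrow>\<^sub>0 'b::comm_ring_1) set" where
  "free_on E = {t. Poly_Mapping.keys t \<subseteq> E}"

definition tensor_rel ::
  "(complex \<Rightarrow> 'b::comm_ring_1) \<Rightarrow> (complex \<Rightarrow> 'v::ab_group_add \<Rightarrow> 'v) \<Rightarrow> 'v set \<Rightarrow> 'v set
     \<Rightarrow> ('v \<Rightarrow>\<^sub>0 'b) set" where
  "tensor_rel \<iota> sc E K = module.span fscale
     ({Poly_Mapping.single (v + w) 1 - Poly_Mapping.single v 1 - Poly_Mapping.single w 1 | v w. v \<in> E \<and> w \<in> E}
      \<union> {Poly_Mapping.single (sc c v) 1 - Poly_Mapping.single v (\<iota> c) | c v. v \<in> E}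
      \<union> {Poly_Mapping.single v 1 | v. v \<in> K})"

text \<open>
  The \<open>'b\<close>-points of the projective space of lines in \<open>V = E / K\<close>: the line subbundles of
  \<open>V \<otimes> B\<close>, i.e. submodules \<open>L\<close>, locally free of rank \<open>1\<close>, with \<open>(V \<otimes> B) / L\<close> locally free
  of rank \<open>dim V - 1\<close>. A submodule of \<open>V \<otimes> B\<close> is given by its preimage in \<open>free_on E\<close>.
\<close>

definition proj_lines ::
  "(complex \<Rightarrow> 'b::comm_ring_1) \<Rightarrow> (complex \<Rightarrow> 'v::ab_group_add \<Rightarrow> 'v) \<Rightarrow> 'v set \<Rightarrow> 'v set
     \<Rightarrow> ('v \<Rightarrow>\<^sub>0 'b) set set" where
  "proj_lines \<iota> sc E K =
     {L. module.subspace fscale L \<and> tensor_rel \<iota> sc E K \<subseteq> L \<and> L \<subseteq> free_on E \<and>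
         locally_free_quot fscale L (tensor_rel \<iota> sc E K) 1 \<and>
         (\<exists>r. free_quot sc E K (Suc r) \<and> locally_free_quot fscale (free_on E) L r)}"

definition pull_sub :: "('b::comm_ring_1 \<Rightarrow> 'c::comm_ring_1) \<Rightarrow> ('v \<Rightarrow>\<^sub>0 'b) set \<Rightarrow> ('v \<Rightarrow>\<^sub>0 'c) set" where
  "pull_sub \<phi> L = module.span fscale (Poly_Mapping.map \<phi> ` L)"


subsection \<open>The identification\<close>

text \<open>
  \<open>tensor_eval\<close> induces the canonical map \<open>Soc\<^sub>p(R / I) \<otimes> B \<rightarrow> (R / I) \<otimes> B = B[x,y] / IB[x,y]\<close>,
  and \<open>soc_line\<close> sends \<open>(I', J)\<close> to the submodule \<open>J / I'\<close>, viewed inside \<open>Soc\<^sub>p(R / I) \<otimes> B\<close>.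
\<close>

definition tensor_eval ::
  "(complex \<Rightarrow> 'b::comm_ring_1) \<Rightarrow> (complex poly poly \<Rightarrow>\<^sub>0 'b) \<Rightarrow> 'b poly poly" where
  "tensor_eval \<iota> t = (\<Sum>h\<in>Poly_Mapping.keys t. pscale (Poly_Mapping.lookup t h) (base_change \<iota> h))"

definition soc_line ::
  "(complex \<Rightarrow> 'b::comm_ring_1) \<Rightarrow> complex poly poly set \<Rightarrow> complex \<times> complex
     \<Rightarrow> 'b poly poly set \<times> 'b poly poly set \<Rightarrow> (complex poly poly \<Rightarrow>\<^sub>0 'b) set" where
  "soc_line \<iota> I p = (\<lambda>(I', J). {t \<in> free_on (soc_num I p). tensor_eval \<iota> t \<in> J})"

end

theory Submission
  imports Defs
begin

text \<open>
  A point of the fibre over \<open>(I, p)\<close> with values in \<open>B\<close> is an ideal \<open>J\<close> of \<open>B[x,y]\<close> that contains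
  \<open>I B[x,y]\<close>, has a locally free quotient of rank \<open>n\<close>, and on which \<open>B[x,y]\<close> acts modulo \<open>I B[x,y]\<close>
  through evaluation at \<open>p\<close>. The last condition says that \<open>J\<close> is contained in the part of \<open>B[x,y]\<close>
  whose class modulo \<open>I B[x,y]\<close> is killed by the maximal ideal of \<open>p\<close>. Everything rests on two facts.

  The first fact is that this part is the scalar extension of the socle (\<open>mem_extend_scalars_soc_iff\<close>).
  This is flatness of \<open>B\<close> over \<open>\<complex>\<close>, used in the following form: an element of \<open>B[x,y]\<close> lies in the
  scalar extension of a complex subspace \<open>W\<close> of \<open>\<complex>[x,y]\<close> iff every \<open>\<complex>\<close>-linear functional on \<open>B\<close>, applied
  to its coefficients, sends it into \<open>W\<close> (\<open>mem_extend_scalars_iff\<close>). A condition over \<open>B\<close> thus becomes the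
  same condition over \<open>\<complex>\<close>. Likewise \<open>Soc \<otimes> B\<close> embeds into \<open>B[x,y] / I B[x,y]\<close> (\<open>tensor_rel_eq\<close>), so
  that the submodules \<open>J\<close> between \<open>I B[x,y]\<close> and the extended socle are exactly the submodules \<open>L\<close> of
  \<open>Soc \<otimes> B\<close>. Such a \<open>J\<close> is automatically an ideal, because \<open>x\<close> and \<open>y\<close> act on it by scalars modulo
  \<open>I B[x,y]\<close>.

  The second fact compares ranks. Write \<open>E\<close> for the extended socle; then \<open>B[x,y] / E\<close> and
  \<open>B[x,y] / I B[x,y]\<close> are free of the expected ranks. If \<open>B[x,y] / J\<close> is locally free of rank \<open>n\<close>, then
  \<open>J / I B[x,y]\<close> and \<open>E / J\<close> are kernels of surjections between locally free modules, hence locally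
  free of the difference of the ranks (\<open>locally_free_kernel\<close>); conversely an extension of locally free
  modules is locally free (\<open>locally_free_extension\<close>). So \<open>J\<close> has a locally free quotient of rank \<open>n\<close> iff
  \<open>J / I B[x,y]\<close> is a line subbundle of \<open>Soc \<otimes> B\<close> (\<open>soc_line_mem_proj_lines_iff\<close>).

  Two more points are needed to speak of the fibre. The residual point is defined by a unique
  description, so it has to be shown that \<open>x\<close> and \<open>y\<close> act on an invertible quotient \<open>J / I\<close> by unique
  scalars (\<open>residual_point_unique_exists\<close>). For naturality, \<open>B[x,y] / J\<close> has to stay locally free
  under a base change \<open>B \<rightarrow> C\<close>; this is \<open>basis_away_base_change\<close>, where the finite generation
  of \<open>B[x,y] / I B[x,y]\<close> makes the denominators uniformly bounded.
\<close>

section \<open>Ideals and powers\<close>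

interpretation ring: module "(*) :: 'a::comm_ring_1 \<Rightarrow> 'a \<Rightarrow> 'a"
  by (rule module_times)

(* For multiplication as scalar action this rule reverses mult.assoc and would make the two loop. *)
declare ring.scale_scale [simp del]

text \<open>
  The radical of an ideal is an ideal: in the binomial expansion of \<open>(x + y) ^ (k + l)\<close> every term
  contains \<open>x ^ k\<close> or \<open>y ^ l\<close>.
\<close>

lemma subspace_radical:
  fixes Q :: "'a::comm_ring_1 set"
  assumes Q: "ring.subspace Q"
  shows "ring.subspace {x. \<exists>k. x ^ k \<in> Q}"
proof (rule ring.subspaceI)
  show "0 \<in> {x. \<exists>k. x ^ k \<in> Q}"
    using ring.subspace_0[OF Q] by (auto intro!: exI[of _ 1])
next
  fix x y assume "x \<in> {x. \<exists>k. x ^ k \<in> Q}" "y \<in> {x. \<exists>k. x ^ k \<in> Q}"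
  then obtain k l where k: "x ^ k \<in> Q" and l: "y ^ l \<in> Q" by auto
  have "(x + y) ^ (k + l) = (\<Sum>i\<le>k + l. of_nat ((k + l) choose i) * x ^ i * y ^ (k + l - i))"
    by (rule binomial_ring)
  also have "\<dots> \<in> Q"
  proof (rule ring.subspace_sum[OF Q])
    fix i assume i: "i \<in> {..k + l}"
    show "of_nat ((k + l) choose i) * x ^ i * y ^ (k + l - i) \<in> Q"
    proof (cases "k \<le> i")
      case True
      then have e: "x ^ i = x ^ (i - k) * x ^ k" by (simp flip: power_add)
      show ?thesis
        using ring.subspace_scale[OF Q k, of "of_nat ((k + l) choose i) * x ^ (i - k) * y ^ (k + l - i)"]
        unfolding e by (simp only: mult_ac)
    next
      case False
      with i have e: "y ^ (k + l - i) = y ^ (k - i) * y ^ l" by (simp flip: power_add)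
      show ?thesis
        using ring.subspace_scale[OF Q l, of "of_nat ((k + l) choose i) * x ^ i * y ^ (k - i)"]
        unfolding e by (simp only: mult_ac)
    qed
  qed
  finally show "x + y \<in> {x. \<exists>k. x ^ k \<in> Q}" by blast
next
  fix c x assume "x \<in> {x. \<exists>k. x ^ k \<in> Q}"
  then obtain k where "x ^ k \<in> Q" by auto
  then have "(c * x) ^ k \<in> Q"
    using ring.subspace_scale[OF Q, of "x ^ k" "c ^ k"] by (simp add: power_mult_distrib)
  then show "c * x \<in> {x. \<exists>k. x ^ k \<in> Q}" by blast
qed

text \<open>
  The form in which partitions of unity are used: to prove a statement about \<open>1\<close>, it is enough that
  the scalars satisfying it form an ideal which contains a power of each \<open>f\<close> in a family generating
  the unit ideal.
\<close>

lemma one_mem_ideal_if_radical: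
  fixes Q :: "'a::comm_ring_1 set"
  assumes Q: "ring.subspace Q" and "1 \<in> ring.span S" and "\<And>f. f \<in> S \<Longrightarrow> \<exists>k. f ^ k \<in> Q"
  shows "1 \<in> Q"
proof -
  have "ring.span S \<subseteq> {x. \<exists>k. x ^ k \<in> Q}"
    by (rule ring.span_minimal[OF _ subspace_radical[OF Q]]) (use assms(3) in auto)
  with assms(2) show ?thesis by auto
qed

lemma finite_subset_in_span:
  fixes x :: "'a::comm_ring_1"
  assumes "x \<in> ring.span S"
  shows "\<exists>F\<subseteq>S. finite F \<and> x \<in> ring.span F"
  using assms
proof -
  obtain t r where "finite t" "t \<subseteq> S" and x: "x = (\<Sum>a\<in>t. r a * a)"
    using assms by (auto simp: ring.span_explicit)
  have "x \<in> ring.span t"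
    unfolding x by (intro ring.span_sum ring.span_scale ring.span_base)
  with \<open>finite t\<close> \<open>t \<subseteq> S\<close> show ?thesis by blast
qed

text \<open>
  Localising introduces an exponent for each element; for finitely many elements one exponent serves
  for all.
\<close>

lemma uniform_exponent:
  fixes P :: "'i \<Rightarrow> nat \<Rightarrow> bool"
  assumes "finite A" and "\<And>i. i \<in> A \<Longrightarrow> \<exists>k. P i k" and "\<And>i k l. P i k \<Longrightarrow> k \<le> l \<Longrightarrow> P i l"
  shows "\<exists>k. \<forall>i\<in>A. P i k"
proof -
  obtain h where h: "\<And>i. i \<in> A \<Longrightarrow> P i (h i)" using assms(2) by metis
  have "\<forall>i\<in>A. P i (Max (insert 0 (h ` A)))"
    using assms(1,3) h by (meson Max_ge finite_imageI finite_insert image_eqI insertCI)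
  then show ?thesis ..
qed

lemma uniform_annihilator:
  fixes f :: "'a::comm_ring_1"
  assumes "finite A" and "\<And>i. i \<in> A \<Longrightarrow> \<exists>k. f ^ k * b i = 0"
  shows "\<exists>k. \<forall>i\<in>A. f ^ k * b i = 0"
proof (rule uniform_exponent[OF assms])
  fix i k l assume "f ^ k * b i = 0" "k \<le> l"
  then show "f ^ l * b i = 0"
    by (metis le_add_diff_inverse2 mult.assoc mult_zero_right power_add)
qed

section \<open>Free and locally free quotients\<close>

text \<open>
  \<open>basis_away\<close> with an arbitrary index set, so that bases can be joined along a disjoint sum of
  index sets and single basis elements can be removed.
\<close>

definition basis_on ::
  "('b::comm_ring_1 \<Rightarrow> 'm::ab_group_add \<Rightarrow> 'm) \<Rightarrow> 'b \<Rightarrow> 'm set \<Rightarrow> 'm set \<Rightarrow> 'i set \<Rightarrow> ('i \<Rightarrow> 'm) \<Rightarrow> bool" where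
  "basis_on s f M N A e \<longleftrightarrow>
     (\<forall>i\<in>A. e i \<in> M) \<and>
     (\<forall>m\<in>M. \<exists>k b. s (f ^ k) m - (\<Sum>i\<in>A. s (b i) (e i)) \<in> N) \<and>
     (\<forall>b. (\<Sum>i\<in>A. s (b i) (e i)) \<in> N \<longrightarrow> (\<forall>i\<in>A. \<exists>k. f ^ k * b i = 0))"

text \<open>
  The scalars \<open>f\<close> such that \<open>M / N\<close> becomes free of rank \<open>r\<close> after inverting \<open>f\<close>. The quotient is locally
  free of rank \<open>r\<close> iff they generate the unit ideal.
\<close>

definition free_locus ::
  "('b::comm_ring_1 \<Rightarrow> 'm::ab_group_add \<Rightarrow> 'm) \<Rightarrow> 'm set \<Rightarrow> 'm set \<Rightarrow> nat \<Rightarrow> 'b set" where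
  "free_locus s M N r = {f. \<exists>e. basis_away s f M N r e}"

context module
begin

lemma basis_on_lessThan: "basis_away (*s) f M N r e \<longleftrightarrow> basis_on (*s) f M N {..<r} e"
  by (auto simp: basis_away_def basis_on_def)

lemma basis_onD:
  assumes "basis_on (*s) f M N A e"
  shows "\<And>i. i \<in> A \<Longrightarrow> e i \<in> M"
    and "\<And>m. m \<in> M \<Longrightarrow> \<exists>k b. f ^ k *s m - (\<Sum>i\<in>A. b i *s e i) \<in> N"
    and "\<And>b i. (\<Sum>i\<in>A. b i *s e i) \<in> N \<Longrightarrow> i \<in> A \<Longrightarrow> \<exists>k. f ^ k * b i = 0"
  using assms unfolding basis_on_def by blast+

lemma basis_on_reindex:
  assumes h: "bij_betw h B A" and e: "basis_on (*s) f M N A e"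
  shows "basis_on (*s) f M N B (e \<circ> h)"
  unfolding basis_on_def
proof (intro conjI ballI allI impI)
  fix i assume "i \<in> B" then show "(e \<circ> h) i \<in> M"
    using basis_onD(1)[OF e] h by (auto simp: bij_betw_def)
next
  fix m assume "m \<in> M"
  then obtain k b where kb: "f ^ k *s m - (\<Sum>i\<in>A. b i *s e i) \<in> N" using basis_onD(2)[OF e] by blast
  have "(\<Sum>i\<in>B. (b \<circ> h) i *s (e \<circ> h) i) = (\<Sum>i\<in>A. b i *s e i)"
    using sum.reindex_bij_betw[OF h, of "\<lambda>i. b i *s e i"] by simp
  with kb show "\<exists>k b. f ^ k *s m - (\<Sum>i\<in>B. b i *s (e \<circ> h) i) \<in> N" by metis
next
  fix b i assume b: "(\<Sum>i\<in>B. b i *s (e \<circ> h) i) \<in> N" and i: "i \<in> B"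
  let ?g = "inv_into B h"
  have gh: "?g (h j) = j" if "j \<in> B" for j using h that by (auto simp: bij_betw_def)
  have "(\<Sum>i\<in>A. b (?g i) *s e i) = (\<Sum>i\<in>B. b i *s (e \<circ> h) i)"
    using sum.reindex_bij_betw[OF h, of "\<lambda>i. b (?g i) *s e i"] gh by simp
  with b have "(\<Sum>i\<in>A. b (?g i) *s e i) \<in> N" by simp
  from basis_onD(3)[OF e this, of "h i"] show "\<exists>k. f ^ k * b i = 0"
    using i h gh by (auto simp: bij_betw_def)
qed

lemma free_locusI:
  assumes "finite A" "basis_on (*s) f M N A e" "card A = r"
  shows "f \<in> free_locus (*s) M N r"
proof -
  obtain h where "bij_betw h {0..<card A} A" using ex_bij_betw_nat_finite[OF assms(1)] by blast
  from basis_on_reindex[OF this assms(2)] show ?thesis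
    using assms(3) by (auto simp: free_locus_def basis_on_lessThan atLeast0LessThan)
qed

lemma basis_on_mult:
  assumes N: "subspace N" and e: "basis_on (*s) f M N A e"
  shows "basis_on (*s) (g * f) M N A e"
  unfolding basis_on_def
proof (intro conjI ballI allI impI)
  fix i assume "i \<in> A" then show "e i \<in> M" using basis_onD(1)[OF e] by blast
next
  fix m assume "m \<in> M"
  then obtain k b where kb: "f ^ k *s m - (\<Sum>i\<in>A. b i *s e i) \<in> N" using basis_onD(2)[OF e] by blast
  from subspace_scale[OF N this, of "g ^ k"]
  have "(g * f) ^ k *s m - (\<Sum>i\<in>A. (g ^ k * b i) *s e i) \<in> N"
    by (simp add: scale_right_diff_distrib scale_sum_right power_mult_distrib)
  then show "\<exists>k b. (g * f) ^ k *s m - (\<Sum>i\<in>A. b i *s e i) \<in> N"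
    by (intro exI[of _ k] exI[of _ "\<lambda>i. g ^ k * b i"])
next
  fix b i assume "(\<Sum>i\<in>A. b i *s e i) \<in> N" "i \<in> A"
  then obtain k where "f ^ k * b i = 0" using basis_onD(3)[OF e] by blast
  then have "(g * f) ^ k * b i = 0" by (simp add: power_mult_distrib mult.assoc)
  then show "\<exists>k. (g * f) ^ k * b i = 0" by blast
qed

lemma free_locus_mult:
  "subspace N \<Longrightarrow> f \<in> free_locus (*s) M N r \<Longrightarrow> g * f \<in> free_locus (*s) M N r"
  unfolding free_locus_def basis_on_lessThan using basis_on_mult by blast

lemma free_locus_mult':
  "subspace N \<Longrightarrow> f \<in> free_locus (*s) M N r \<Longrightarrow> f * g \<in> free_locus (*s) M N r"
  using free_locus_mult[of N f M r g] by (simp add: mult.commute)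

lemma locally_free_iff:
  "locally_free_quot (*s) M N r \<longleftrightarrow> 1 \<in> ring.span (free_locus (*s) M N r)"
proof
  assume "locally_free_quot (*s) M N r"
  then obtain F where "1 \<in> ring.span F" "F \<subseteq> free_locus (*s) M N r"
    by (auto simp: locally_free_quot_def free_locus_def)
  then show "1 \<in> ring.span (free_locus (*s) M N r)" using ring.span_mono by blast
next
  assume "1 \<in> ring.span (free_locus (*s) M N r)"
  from finite_subset_in_span[OF this] show "locally_free_quot (*s) M N r"
    by (auto simp: locally_free_quot_def free_locus_def subset_eq)
qed

lemma free_imp_locally_free: "free_quot (*s) M N r \<Longrightarrow> locally_free_quot (*s) M N r"
  unfolding locally_free_iff by (rule ring.span_base) (simp add: free_locus_def free_quot_def)

text \<open>
  A basis of \<open>W / M\<close> together with a basis of \<open>M / N\<close> is a basis of \<open>W / N\<close>.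
\<close>

lemma free_locus_extension:
  assumes W: "subspace W" and M: "subspace M" and N: "subspace N" and "N \<subseteq> M" "M \<subseteq> W"
    and f: "f \<in> free_locus (*s) W M m" "f \<in> free_locus (*s) M N r"
  shows "f \<in> free_locus (*s) W N (m + r)"
proof -
  obtain w u where w: "basis_on (*s) f W M {..<m} w" and u: "basis_on (*s) f M N {..<r} u"
    using f by (auto simp: free_locus_def basis_on_lessThan)
  define e where "e = case_sum w u"
  let ?A = "{..<m} <+> {..<r}"
  have sum_e: "(\<Sum>i\<in>?A. b i *s e i) = (\<Sum>i<m. b (Inl i) *s w i) + (\<Sum>i<r. b (Inr i) *s u i)" for b
    by (subst sum.Plus) (auto simp: e_def)
  have "basis_on (*s) f W N ?A e"
    unfolding basis_on_def sum_e
  proof (intro conjI ballI allI impI)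
    fix i assume "i \<in> ?A"
    then show "e i \<in> W" using basis_onD(1)[OF w] basis_onD(1)[OF u] \<open>M \<subseteq> W\<close> by (auto simp: e_def)
  next
    fix x assume "x \<in> W"
    then obtain k b where kb: "f ^ k *s x - (\<Sum>i<m. b i *s w i) \<in> M" using basis_onD(2)[OF w] by blast
    then obtain l c where "f ^ l *s (f ^ k *s x - (\<Sum>i<m. b i *s w i)) - (\<Sum>i<r. c i *s u i) \<in> N"
      using basis_onD(2)[OF u] by blast
    then have "f ^ (l + k) *s x - ((\<Sum>i<m. (f ^ l * b i) *s w i) + (\<Sum>i<r. c i *s u i)) \<in> N"
      by (simp add: scale_right_diff_distrib scale_sum_right power_add algebra_simps)
    then show "\<exists>k b. f ^ k *s x - ((\<Sum>i<m. b (Inl i) *s w i) + (\<Sum>i<r. b (Inr i) *s u i)) \<in> N"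
      by (intro exI[of _ "l + k"] exI[of _ "case_sum (\<lambda>i. f ^ l * b i) c"]) simp
  next
    fix b i assume b: "(\<Sum>i<m. b (Inl i) *s w i) + (\<Sum>i<r. b (Inr i) *s u i) \<in> N" and i: "i \<in> ?A"
    have "(\<Sum>i<r. b (Inr i) *s u i) \<in> M"
      using basis_onD(1)[OF u] by (intro subspace_sum[OF M] subspace_scale[OF M]) auto
    with b \<open>N \<subseteq> M\<close> have "(\<Sum>i<m. b (Inl i) *s w i) \<in> M"
      by (metis subsetD add_diff_cancel_right' subspace_diff[OF M])
    then have wz: "\<exists>k. f ^ k * b (Inl i) = 0" if "i < m" for i
      using basis_onD(3)[OF w, of "\<lambda>i. b (Inl i)" i] that by simp
    then obtain k where k: "\<forall>i\<in>{..<m}. f ^ k * b (Inl i) = 0"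
      using uniform_annihilator[of "{..<m}" f "\<lambda>i. b (Inl i)"] by auto
    have "(\<Sum>i<r. (f ^ k * b (Inr i)) *s u i) \<in> N"
      using subspace_scale[OF N b, of "f ^ k"] k
      by (simp add: scale_right_distrib scale_sum_right)
    then have "\<exists>l. f ^ l * (f ^ k * b (Inr i)) = 0" if "i < r" for i
      using basis_onD(3)[OF u, of "\<lambda>i. f ^ k * b (Inr i)" i] that by simp
    then have "\<exists>l. f ^ l * b (Inr i) = 0" if "i < r" for i
      using that by (metis mult.assoc power_add)
    with wz i show "\<exists>k. f ^ k * b i = 0" by auto
  qed
  then show ?thesis by (intro free_locusI) (auto simp: card_Plus)
qed

lemma one_mem_span_products:
  fixes S T U :: "'c::comm_ring_1 set"
  assumes "1 \<in> ring.span S" "1 \<in> ring.span T" and ST: "\<And>f g. f \<in> S \<Longrightarrow> g \<in> T \<Longrightarrow> f * g \<in> ring.span U"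
  shows "1 \<in> ring.span U"
proof -
  have "f \<in> ring.span U" if f: "f \<in> S" for f
  proof -
    have "ring.subspace {g. f * g \<in> ring.span U}"
      by (intro ring.subspaceI)
        (simp_all only: mem_Collect_eq distrib_left mult_zero_right ring.span_zero ring.span_add
          mult.left_commute[of f] ring.span_scale)
    then have "ring.span T \<subseteq> {g. f * g \<in> ring.span U}"
      using ST[OF f] by (intro ring.span_minimal) auto
    with assms(2) show ?thesis by auto
  qed
  then have "ring.span S \<subseteq> ring.span U" by (intro ring.span_minimal) auto
  with assms(1) show ?thesis by auto
qed

lemma locally_free_extension:
  assumes sub: "subspace W" "subspace M" "subspace N" "N \<subseteq> M" "M \<subseteq> W"
    and "locally_free_quot (*s) W M m" "locally_free_quot (*s) M N r"
  shows "locally_free_quot (*s) W N (m + r)"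
  unfolding locally_free_iff
proof (rule one_mem_span_products)
  show "1 \<in> ring.span (free_locus (*s) W M m)" "1 \<in> ring.span (free_locus (*s) M N r)"
    using assms by (simp_all add: locally_free_iff)
  fix f g assume "f \<in> free_locus (*s) W M m" "g \<in> free_locus (*s) M N r"
  then show "f * g \<in> ring.span (free_locus (*s) W N (m + r))"
    using free_locus_extension[OF sub, of "f * g"] free_locus_mult free_locus_mult' sub
    by (intro ring.span_base) blast
qed

lemma uniform_multiple:
  assumes M: "subspace M" and "finite A"
    and "\<And>i. i \<in> A \<Longrightarrow> \<exists>k c. f ^ k *s x i - c *s w \<in> M"
  shows "\<exists>k c. \<forall>i\<in>A. f ^ k *s x i - c i *s w \<in> M"
proof -
  have "\<exists>k. \<forall>i\<in>A. \<exists>c. f ^ k *s x i - c *s w \<in> M"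
  proof (rule uniform_exponent[OF assms(2,3)])
    fix i and k l :: nat assume "\<exists>c. f ^ k *s x i - c *s w \<in> M" "k \<le> l"
    then obtain c where c: "f ^ k *s x i - c *s w \<in> M" by blast
    have "f ^ l *s x i - (f ^ (l - k) * c) *s w = f ^ (l - k) *s (f ^ k *s x i - c *s w)"
      using \<open>k \<le> l\<close> by (simp add: scale_right_diff_distrib flip: power_add)
    with subspace_scale[OF M c, of "f ^ (l - k)"] show "\<exists>c. f ^ l *s x i - c *s w \<in> M" by metis
  qed
  then show ?thesis by metis
qed

text \<open>
  Let \<open>w\<close> generate \<open>W / M\<close> and let \<open>u\<^sub>0, \<dots>, u\<^sub>r\<close> be a basis of \<open>W / N\<close>, all after inverting \<open>f\<close>. The
  surjection \<open>W / N \<rightarrow> W / M\<close> is a row of scalars \<open>\<phi>\<^sub>i\<close>, which generate the unit ideal because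
  it hits \<open>w\<close>. Where \<open>\<phi>\<^sub>p\<close> is invertible, the kernel \<open>M / N\<close> has the basis \<open>\<phi>\<^sub>p u\<^sub>j - \<phi>\<^sub>j u\<^sub>p\<close> for
  \<open>j \<noteq> p\<close>. So \<open>M / N\<close> is free of rank \<open>r\<close> over each \<open>f * \<phi>\<^sub>p\<close>, and a power of \<open>f\<close> is a combination
  of these scalars.
\<close>

lemma free_locus_kernel_rank_one:
  assumes M: "subspace M" and N: "subspace N" and "N \<subseteq> M" "M \<subseteq> W"
    and f: "f \<in> free_locus (*s) W N (Suc r)" "f \<in> free_locus (*s) W M 1"
  shows "\<exists>k. f ^ k \<in> ring.span (free_locus (*s) M N r)"
proof -
  obtain u w where u: "basis_on (*s) f W N {..<Suc r} u" and w: "basis_on (*s) f W M {..<1::nat} w"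
    using f by (auto simp: free_locus_def basis_on_lessThan)
  define A where "A = {..<Suc r}"
  have A: "finite A" "card A = Suc r" by (simp_all add: A_def)
  note u = u[folded A_def]
  let ?w = "w 0"
  have wW: "?w \<in> W" using basis_onD(1)[OF w, of 0] by simp
  have w1: "\<exists>k c. f ^ k *s x - c *s ?w \<in> M" if "x \<in> W" for x
    using basis_onD(2)[OF w that] by auto
  have w2: "\<exists>k. f ^ k * c = 0" if "c *s ?w \<in> M" for c
    using basis_onD(3)[OF w, of "\<lambda>_. c" 0] that by simp
  obtain K \<phi> where \<phi>: "\<And>i. i \<in> A \<Longrightarrow> f ^ K *s u i - \<phi> i *s ?w \<in> M"
    using uniform_multiple[OF M A(1), of f u ?w] w1 basis_onD(1)[OF u] by blast
  have comb: "(f ^ K *s (\<Sum>i\<in>A. b i *s u i)) - (\<Sum>i\<in>A. b i * \<phi> i) *s ?w \<in> M" for b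
  proof -
    have "(\<Sum>i\<in>A. b i *s (f ^ K *s u i - \<phi> i *s ?w)) \<in> M"
      using \<phi> by (intro subspace_sum[OF M] subspace_scale[OF M]) auto
    then show ?thesis
      by (simp only: scale_right_diff_distrib sum_subtractf scale_sum_right scale_sum_left scale_scale
          mult.commute)
  qed
  have loc: "f * \<phi> p \<in> free_locus (*s) M N r" if p: "p \<in> A" for p
  proof -
    \<comment> \<open>Each \<open>v j\<close> is mapped to \<open>0\<close> in \<open>W / M\<close>; the factor \<open>f ^ K\<close> makes this hold before localisation.\<close>
    define v where "v j = f ^ K *s (\<phi> p *s u j - \<phi> j *s u p)" for j
    let ?B = "A - {p}"
    have sum_v: "(\<Sum>j\<in>?B. c j *s v j) = (\<Sum>j\<in>A. (if j = p then - (f ^ K) * (\<Sum>j\<in>?B. c j * \<phi> j) else f ^ K * \<phi> p * c j) *s u j)" for c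
    proof -
      have "(\<Sum>j\<in>A. (if j = p then - (f ^ K) * (\<Sum>j\<in>?B. c j * \<phi> j) else f ^ K * \<phi> p * c j) *s u j)
        = (- (f ^ K) * (\<Sum>j\<in>?B. c j * \<phi> j)) *s u p + (\<Sum>j\<in>?B. (f ^ K * \<phi> p * c j) *s u j)"
        using A p by (subst sum.remove[OF _ p]) simp_all
      also have "(- (f ^ K) * (\<Sum>j\<in>?B. c j * \<phi> j)) *s u p = - (\<Sum>j\<in>?B. (f ^ K * c j * \<phi> j) *s u p)"
        unfolding scale_sum_left[symmetric] sum_distrib_left mult.assoc mult_minus_left
          sum_negf scale_minus_left ..
      also have "- (\<Sum>j\<in>?B. (f ^ K * c j * \<phi> j) *s u p) + (\<Sum>j\<in>?B. (f ^ K * \<phi> p * c j) *s u j)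
        = (\<Sum>j\<in>?B. (f ^ K * \<phi> p * c j) *s u j - (f ^ K * c j * \<phi> j) *s u p)"
        by (simp only: sum_subtractf uminus_add_conv_diff)
      also have "\<dots> = (\<Sum>j\<in>?B. c j *s v j)"
        unfolding v_def scale_right_diff_distrib scale_scale by (simp only: mult_ac)
      finally show ?thesis by (rule sym)
    qed
    have "basis_on (*s) (f * \<phi> p) M N ?B v"
      unfolding basis_on_def
    proof (intro conjI ballI allI impI)
      fix j assume j: "j \<in> ?B"
      have "\<phi> p *s (f ^ K *s u j - \<phi> j *s ?w) - \<phi> j *s (f ^ K *s u p - \<phi> p *s ?w) \<in> M"
        by (rule subspace_diff[OF M subspace_scale[OF M] subspace_scale[OF M]]) (use \<phi> p j in auto)
      moreover have "\<phi> p *s (f ^ K *s u j - \<phi> j *s ?w) - \<phi> j *s (f ^ K *s u p - \<phi> p *s ?w) = v j"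
        by (simp add: v_def scale_right_diff_distrib mult.commute[of "\<phi> p" "\<phi> j"]
            mult.commute[of _ "f ^ K"])
      ultimately show "v j \<in> M" by simp
    next
      fix x assume x: "x \<in> M"
      then obtain k b where kb: "f ^ k *s x - (\<Sum>i\<in>A. b i *s u i) \<in> N"
        using basis_onD(2)[OF u] \<open>M \<subseteq> W\<close> by blast
      have "(\<Sum>i\<in>A. b i *s u i) = f ^ k *s x - (f ^ k *s x - (\<Sum>i\<in>A. b i *s u i))" by simp
      also have "\<dots> \<in> M"
        by (rule subspace_diff[OF M subspace_scale[OF M x]]) (use kb \<open>N \<subseteq> M\<close> in auto)
      finally have "f ^ K *s (\<Sum>i\<in>A. b i *s u i) \<in> M" by (rule subspace_scale[OF M])
      from subspace_diff[OF M this comb[of b]] have "(\<Sum>i\<in>A. b i * \<phi> i) *s ?w \<in> M" by simp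
      then obtain l where l: "f ^ l * (\<Sum>i\<in>A. b i * \<phi> i) = 0" using w2 by blast
      let ?n = "Suc (l + K + k)"
      define g where "g = f * \<phi> p ^ (l + K + k)"
      have pw: "(f * \<phi> p) ^ ?n = g * f ^ l * f ^ K * \<phi> p * f ^ k"
        by (simp add: g_def power_mult_distrib power_add mult_ac)
      have lp: "f ^ l * (b p * \<phi> p) = - (f ^ l * (\<Sum>j\<in>?B. b j * \<phi> j))"
        using l A by (subst (asm) sum.remove[OF _ p]) (simp_all add: distrib_left eq_neg_iff_add_eq_0)
      have "(g * f ^ l * f ^ K * \<phi> p) *s (f ^ k *s x - (\<Sum>i\<in>A. b i *s u i)) \<in> N"
        by (rule subspace_scale[OF N kb])
      also have "(g * f ^ l * f ^ K * \<phi> p) *s (f ^ k *s x - (\<Sum>i\<in>A. b i *s u i))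
        = (f * \<phi> p) ^ ?n *s x - (\<Sum>i\<in>A. (g * f ^ l * f ^ K * \<phi> p * b i) *s u i)"
        unfolding pw by (simp only: scale_right_diff_distrib scale_sum_right scale_scale)
      also have "(\<Sum>i\<in>A. (g * f ^ l * f ^ K * \<phi> p * b i) *s u i) = (\<Sum>j\<in>?B. (g * f ^ l * b j) *s v j)"
        unfolding sum_v
      proof (rule sum.cong[OF refl])
        fix i
        have "g * f ^ l * f ^ K * \<phi> p * b p = g * f ^ K * (f ^ l * (b p * \<phi> p))" by (simp add: mult_ac)
        also have "\<dots> = - (f ^ K) * (\<Sum>j\<in>?B. g * f ^ l * b j * \<phi> j)"
          unfolding lp by (simp add: sum_distrib_left sum_negf mult_ac)
        finally show "(g * f ^ l * f ^ K * \<phi> p * b i) *s u i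
          = (if i = p then - (f ^ K) * (\<Sum>j\<in>?B. g * f ^ l * b j * \<phi> j) else f ^ K * \<phi> p * (g * f ^ l * b i)) *s u i"
          by (simp add: mult_ac)
      qed
      finally show "\<exists>n b. (f * \<phi> p) ^ n *s x - (\<Sum>i\<in>?B. b i *s v i) \<in> N"
        by (intro exI[of _ ?n] exI[of _ "\<lambda>j. g * f ^ l * b j"])
    next
      fix c j assume c: "(\<Sum>j\<in>?B. c j *s v j) \<in> N" and j: "j \<in> ?B"
      then obtain k where "f ^ k * (f ^ K * \<phi> p * c j) = 0"
        using basis_onD(3)[OF u c[unfolded sum_v], of j] by auto
      moreover have "(f * \<phi> p) ^ (k + K + 1) * c j = (f * \<phi> p ^ (k + K)) * (f ^ k * (f ^ K * \<phi> p * c j))"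
        by (simp add: power_mult_distrib power_add mult_ac)
      ultimately have "(f * \<phi> p) ^ (k + K + 1) * c j = 0" by simp
      then show "\<exists>k. (f * \<phi> p) ^ k * c j = 0" by blast
    qed
    moreover have "card ?B = r" using p A by simp
    ultimately show ?thesis by (intro free_locusI[of ?B]) (simp_all add: A)
  qed
  obtain k b where kb: "f ^ k *s ?w - (\<Sum>i\<in>A. b i *s u i) \<in> N"
    using basis_onD(2)[OF u wW] by blast
  let ?s = "\<Sum>i\<in>A. b i * \<phi> i"
  have "f ^ K *s (f ^ k *s ?w - (\<Sum>i\<in>A. b i *s u i)) \<in> M"
    using kb \<open>N \<subseteq> M\<close> by (intro subspace_scale[OF M]) auto
  from subspace_add[OF M this comb[of b]] have "(f ^ (K + k) - ?s) *s ?w \<in> M"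
    by (simp add: scale_right_diff_distrib scale_left_diff_distrib power_add)
  then obtain j where "f ^ j * (f ^ (K + k) - ?s) = 0" using w2 by blast
  then have "f ^ (j + (K + k)) = f ^ j * ?s" by (simp add: power_add right_diff_distrib)
  then have "f ^ Suc (j + (K + k)) = (\<Sum>i\<in>A. (f ^ j * b i) * (f * \<phi> i))"
    by (simp add: sum_distrib_left mult_ac)
  also have "\<dots> \<in> ring.span (free_locus (*s) M N r)"
    by (intro ring.span_sum ring.span_scale ring.span_base loc)
  finally show ?thesis by blast
qed

text \<open>
  The kernel of a surjection from rank \<open>m + r\<close> to rank \<open>m\<close>, by induction on \<open>m\<close>: the preimage \<open>M'\<close> of
  the line spanned by the last basis element of \<open>W / M\<close> has a quotient \<open>W / M'\<close> of smaller rank, and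
  \<open>M\<close> is the kernel of the rank one quotient \<open>M' / M\<close>.
\<close>

lemma free_locus_kernel:
  assumes W: "subspace W" and N: "subspace N"
    and "subspace M" "N \<subseteq> M" "M \<subseteq> W" "f \<in> free_locus (*s) W N (m + r)" "f \<in> free_locus (*s) W M m"
  shows "\<exists>k. f ^ k \<in> ring.span (free_locus (*s) M N r)"
  using assms(3-)
proof (induction m arbitrary: M r)
  case 0
  from 0 obtain u e where u: "basis_on (*s) f W N {..<r} u" and e: "basis_on (*s) f W M {..<0::nat} e"
    by (auto simp: free_locus_def basis_on_lessThan)
  have "\<exists>k. f ^ k *s x \<in> M" if "x \<in> W" for x using e that by (auto simp: basis_on_def)
  then have "\<exists>k c. f ^ k *s u i - c *s 0 \<in> M" if "i \<in> {..<r}" for i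
    using basis_onD(1)[OF u that] by auto
  then obtain K where K: "\<forall>i\<in>{..<r}. f ^ K *s u i \<in> M"
    using uniform_multiple[OF \<open>subspace M\<close>, of "{..<r}" f u 0] by auto
  have "basis_on (*s) f M N {..<r} (\<lambda>i. f ^ K *s u i)"
    unfolding basis_on_def
  proof (intro conjI allI impI)
    show "\<forall>m\<in>M. \<exists>k b. f ^ k *s m - (\<Sum>i<r. b i *s (f ^ K *s u i)) \<in> N"
    proof
      fix x assume "x \<in> M"
      then obtain k b where "f ^ k *s x - (\<Sum>i<r. b i *s u i) \<in> N"
        using basis_onD(2)[OF u] \<open>M \<subseteq> W\<close> by blast
      from subspace_scale[OF N this, of "f ^ K"]
      have "f ^ (K + k) *s x - (\<Sum>i<r. b i *s (f ^ K *s u i)) \<in> N"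
        by (simp add: scale_right_diff_distrib scale_sum_right power_add mult_ac)
      then show "\<exists>k b. f ^ k *s x - (\<Sum>i<r. b i *s (f ^ K *s u i)) \<in> N" by blast
    qed
    fix b assume "(\<Sum>i<r. b i *s (f ^ K *s u i)) \<in> N"
    then have "(\<Sum>i<r. (b i * f ^ K) *s u i) \<in> N" by simp
    from basis_onD(3)[OF u this] show "\<forall>i\<in>{..<r}. \<exists>k. f ^ k * b i = 0"
      by (metis mult.assoc mult.commute power_add)
  qed (use K in simp)
  then have "f ^ 1 \<in> free_locus (*s) M N r" by (intro free_locusI) auto
  then show ?case using ring.span_base by blast
next
  case (Suc m)
  from Suc.prems obtain w where w: "basis_on (*s) f W M {..<Suc m} w"
    by (auto simp: free_locus_def basis_on_lessThan)
  have wW: "w i \<in> W" if "i < Suc m" for i using basis_onD(1)[OF w] that by simp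
  note M = \<open>subspace M\<close>
  \<comment> \<open>The preimage in \<open>W\<close> of the line spanned by \<open>w m\<close> in the localisation of \<open>W / M\<close>.\<close>
  define M' where "M' = {x\<in>W. \<exists>k c. f ^ k *s x - c *s w m \<in> M}"
  have M': "subspace M'"
  proof (rule subspaceI)
    show "0 \<in> M'" using subspace_0[OF W] subspace_0[OF M]
      by (auto simp: M'_def intro!: exI[of _ 0] exI[of _ 0])
  next
    fix x y assume "x \<in> M'" "y \<in> M'"
    then obtain k c l d where *: "f ^ k *s x - c *s w m \<in> M" "f ^ l *s y - d *s w m \<in> M"
      and xy: "x \<in> W" "y \<in> W" by (auto simp: M'_def)
    have "f ^ l *s (f ^ k *s x - c *s w m) + f ^ k *s (f ^ l *s y - d *s w m) \<in> M"
      by (intro subspace_add[OF M] subspace_scale[OF M] *)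
    then have "f ^ (l + k) *s (x + y) - (f ^ l * c + f ^ k * d) *s w m \<in> M"
      by (simp add: scale_right_diff_distrib scale_right_distrib scale_left_distrib power_add algebra_simps)
    with xy show "x + y \<in> M'" using subspace_add[OF W] by (auto simp: M'_def)
  next
    fix a x assume "x \<in> M'"
    then obtain k c where *: "f ^ k *s x - c *s w m \<in> M" "x \<in> W" by (auto simp: M'_def)
    from subspace_scale[OF M *(1), of a] have "f ^ k *s (a *s x) - (a * c) *s w m \<in> M"
      by (simp add: scale_right_diff_distrib mult_ac)
    with *(2) show "a *s x \<in> M'" using subspace_scale[OF W] by (auto simp: M'_def)
  qed
  have MM': "M \<subseteq> M'" using \<open>M \<subseteq> W\<close> by (auto simp: M'_def intro!: exI[of _ 0] exI[of _ 0])
  have "M' \<subseteq> W" by (auto simp: M'_def)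
  have "basis_on (*s) f W M' {..<m} w"
    unfolding basis_on_def
  proof (intro conjI ballI allI impI)
    fix x assume x: "x \<in> W"
    then obtain k b where kb: "f ^ k *s x - (\<Sum>i<Suc m. b i *s w i) \<in> M" using basis_onD(2)[OF w] by blast
    have "f ^ 0 *s (f ^ k *s x - (\<Sum>i<m. b i *s w i)) - b m *s w m \<in> M"
      using kb by (simp add: algebra_simps)
    moreover have "f ^ k *s x - (\<Sum>i<m. b i *s w i) \<in> W"
      using x wW by (intro subspace_diff[OF W] subspace_sum[OF W] subspace_scale[OF W]) auto
    ultimately show "\<exists>k b. f ^ k *s x - (\<Sum>i<m. b i *s w i) \<in> M'"
      unfolding M'_def by blast
  next
    fix b i assume "(\<Sum>i<m. b i *s w i) \<in> M'" and i: "i \<in> {..<m}"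
    then obtain k c where "f ^ k *s (\<Sum>i<m. b i *s w i) - c *s w m \<in> M" by (auto simp: M'_def)
    then have "(\<Sum>i<Suc m. (if i = m then - c else f ^ k * b i) *s w i) \<in> M"
      by (simp add: scale_sum_right)
    from basis_onD(3)[OF w this, of i] i obtain l where "f ^ l * (f ^ k * b i) = 0" by auto
    then show "\<exists>k. f ^ k * b i = 0" by (metis mult.assoc power_add)
  qed (use wW in simp)
  then have fm: "f \<in> free_locus (*s) W M' m" by (intro free_locusI) auto
  have "basis_on (*s) f M' M {..<1::nat} (\<lambda>_. w m)"
    unfolding basis_on_def
  proof (intro conjI ballI allI impI)
    have "f ^ 0 *s w m - 1 *s w m \<in> M" using subspace_0[OF M] by simp
    then show "w m \<in> M'" using wW[of m] unfolding M'_def by blast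
    fix x assume "x \<in> M'"
    then obtain k c where "f ^ k *s x - c *s w m \<in> M" by (auto simp: M'_def)
    then show "\<exists>k b. f ^ k *s x - (\<Sum>i<1::nat. b i *s w m) \<in> M"
      by (intro exI[of _ k] exI[of _ "\<lambda>_. c"]) simp
  next
    fix b i assume b: "(\<Sum>i<1::nat. b i *s w m) \<in> M" and i: "i \<in> {..<1::nat}"
    then have "(\<Sum>i<Suc m. (if i = m then b 0 else 0) *s w i) \<in> M" by simp
    from basis_onD(3)[OF w this, of m] i show "\<exists>k. f ^ k * b i = 0" by auto
  qed
  then have f1: "f \<in> free_locus (*s) M' M 1" by (intro free_locusI) auto
  obtain k where k: "f ^ k \<in> ring.span (free_locus (*s) M' N (Suc r))"
    using Suc.IH[OF M' _ \<open>M' \<subseteq> W\<close> _ fm, of "Suc r"] Suc.prems MM' by auto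
  let ?R = "{x. \<exists>k. x ^ k \<in> ring.span (free_locus (*s) M N r)}"
  have R: "ring.subspace ?R" by (rule subspace_radical) simp
  have "free_locus (*s) M' N (Suc r) \<subseteq> {g. f * g \<in> ?R}"
  proof
    fix g assume "g \<in> free_locus (*s) M' N (Suc r)"
    then have "f * g \<in> free_locus (*s) M' N (Suc r)" "f * g \<in> free_locus (*s) M' M 1"
      using free_locus_mult[OF N] free_locus_mult'[OF M] f1 by auto
    from free_locus_kernel_rank_one[OF M N \<open>N \<subseteq> M\<close> MM' this] show "g \<in> {g. f * g \<in> ?R}" by simp
  qed
  moreover have "ring.subspace {g. f * g \<in> ?R}"
  proof (rule ring.subspaceI)
    show "0 \<in> {g. f * g \<in> ?R}" using ring.subspace_0[OF R] by simp
    show "x + y \<in> {g. f * g \<in> ?R}" if "x \<in> {g. f * g \<in> ?R}" "y \<in> {g. f * g \<in> ?R}" for x y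
      using ring.subspace_add[OF R, of "f * x" "f * y"] that by (simp add: distrib_left)
    show "c * x \<in> {g. f * g \<in> ?R}" if "x \<in> {g. f * g \<in> ?R}" for c x
      using ring.subspace_scale[OF R, of "f * x" c] that by (simp only: mem_Collect_eq mult.left_commute[of f c x])
  qed
  ultimately have "f * f ^ k \<in> ?R" using ring.span_minimal k by blast
  then obtain l where "(f ^ Suc k) ^ l \<in> ring.span (free_locus (*s) M N r)" by auto
  then show ?case unfolding power_mult[symmetric] by blast
qed

lemma locally_free_kernel:
  assumes sub: "subspace W" "subspace N" "subspace M" "N \<subseteq> M" "M \<subseteq> W"
    and "locally_free_quot (*s) W N (m + r)" "locally_free_quot (*s) W M m"
  shows "locally_free_quot (*s) M N r"
  unfolding locally_free_iff
proof (rule one_mem_ideal_if_radical)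
  show "1 \<in> ring.span {f * g | f g. f \<in> free_locus (*s) W N (m + r) \<and> g \<in> free_locus (*s) W M m}"
  proof (rule one_mem_span_products)
    show "1 \<in> ring.span (free_locus (*s) W N (m + r))" "1 \<in> ring.span (free_locus (*s) W M m)"
      using assms by (simp_all add: locally_free_iff)
  qed (blast intro: ring.span_base)
  fix h assume "h \<in> {f * g | f g. f \<in> free_locus (*s) W N (m + r) \<and> g \<in> free_locus (*s) W M m}"
  then have "h \<in> free_locus (*s) W N (m + r)" "h \<in> free_locus (*s) W M m"
    using free_locus_mult'[OF sub(2)] free_locus_mult[OF sub(3)] by blast+
  then show "\<exists>k. h ^ k \<in> ring.span (free_locus (*s) M N r)"
    by (rule free_locus_kernel[OF sub])
qed simp

text \<open>
  Over a nonzero ring the zero module has no positive rank: a basis element would be killed by \<open>1\<close>,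
  so every scalar in the free locus would be nilpotent.
\<close>

lemma locally_free_zero_quot:
  assumes N: "subspace N" and "locally_free_quot (*s) N N r"
  shows "r = 0"
proof (rule ccontr)
  assume "r \<noteq> 0"
  have "1 \<in> {0::'a}"
  proof (rule one_mem_ideal_if_radical)
    show "1 \<in> ring.span (free_locus (*s) N N r)" using assms by (simp add: locally_free_iff)
    fix f assume "f \<in> free_locus (*s) N N r"
    then obtain e where e: "basis_on (*s) f N N {..<r} e" by (auto simp: free_locus_def basis_on_lessThan)
    have "(\<Sum>i<r. 1 *s e i) \<in> N"
      using basis_onD(1)[OF e] by (intro subspace_sum[OF N] subspace_scale[OF N])
    from basis_onD(3)[OF e this, of 0] \<open>r \<noteq> 0\<close> show "\<exists>k. f ^ k \<in> {0}" by simp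
  qed simp
  then show False by simp
qed

text \<open>
  If \<open>a < b\<close> were both ranks, the kernel of the identity would have rank \<open>b - a\<close>.
\<close>

lemma locally_free_rank_unique:
  assumes "subspace W" "subspace N" "N \<subseteq> W"
    and "locally_free_quot (*s) W N a" "locally_free_quot (*s) W N b"
  shows "a = b"
proof -
  have "b \<le> a" if "locally_free_quot (*s) W N a" "locally_free_quot (*s) W N b" for a b
  proof (rule ccontr)
    assume "\<not> b \<le> a"
    then have "locally_free_quot (*s) N N (b - a)"
      using locally_free_kernel[OF assms(1,2,2), of a "b - a"] assms(3) that by simp
    from locally_free_zero_quot[OF assms(2) this] \<open>\<not> b \<le> a\<close> show False by simp
  qed
  with assms show ?thesis by (meson antisym)
qed

section \<open>Lines: faithfulness and endomorphisms\<close>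

lemma mem_if_locally_mem:
  assumes N: "subspace N" and "1 \<in> ring.span F" and "\<And>f. f \<in> F \<Longrightarrow> \<exists>k. f ^ k *s x \<in> N"
  shows "x \<in> N"
proof -
  have "ring.subspace {b. b *s x \<in> N}"
  proof (rule ring.subspaceI)
    show "0 \<in> {b. b *s x \<in> N}" using subspace_0[OF N] by simp
    show "a + b \<in> {b. b *s x \<in> N}" if "a \<in> {b. b *s x \<in> N}" "b \<in> {b. b *s x \<in> N}" for a b
      using subspace_add[OF N, of "a *s x" "b *s x"] that by (simp add: scale_left_distrib)
    show "c * b \<in> {b. b *s x \<in> N}" if "b \<in> {b. b *s x \<in> N}" for c b
      using subspace_scale[OF N, of "b *s x" c] that by simp
  qed
  from one_mem_ideal_if_radical[OF this assms(2)] assms(3) show ?thesis by simp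
qed

lemma scalar_eq_0_if_kills_line:
  assumes N: "subspace N" and L: "locally_free_quot (*s) M N 1" and a: "\<And>x. x \<in> M \<Longrightarrow> a *s x \<in> N"
  shows "a = 0"
proof -
  have "a \<in> {0}"
  proof (rule module.mem_if_locally_mem[OF module_times])
    show "ring.subspace {0::'a}" by simp
    show "1 \<in> ring.span (free_locus (*s) M N 1)" using L by (simp add: locally_free_iff)
    fix f assume "f \<in> free_locus (*s) M N 1"
    then obtain e where e: "basis_on (*s) f M N {..<1::nat} e" by (auto simp: free_locus_def basis_on_lessThan)
    have "(\<Sum>i<1::nat. a *s e i) \<in> N" using a basis_onD(1)[OF e, of 0] by simp
    from basis_onD(3)[OF e this, of 0] show "\<exists>k. f ^ k * a \<in> {0}" by simp
  qed
  then show ?thesis by simp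
qed

text \<open>
  Over each \<open>f\<close> of a finite cover the line is generated by one element \<open>e f\<close>, and \<open>T\<close> acts by a scalar
  there. To glue these scalars one would like the set of \<open>b\<close> such that \<open>b T\<close> is multiplication by some
  scalar to contain a power of each \<open>f\<close>; but the exponent may depend on the element acted upon. It is
  uniform on the finitely many local generators, which gives one scalar that is right on all \<open>e f\<close>, and
  these generate the line locally.
\<close>

lemma endomorphism_of_line_is_scalar:
  assumes M: "subspace M" and N: "subspace N" and NM: "N \<subseteq> M" and L: "locally_free_quot (*s) M N 1"
    and T: "module_hom (*s) (*s) T" and TM: "T ` M \<subseteq> M" and TN: "T ` N \<subseteq> N"
  shows "\<exists>a. \<forall>x\<in>M. T x - a *s x \<in> N"
proof -
  interpret T: module_hom "(*s)" "(*s)" T by (rule T)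
  obtain F where F: "finite F" "1 \<in> ring.span F" "\<And>f. f \<in> F \<Longrightarrow> \<exists>e. basis_away (*s) f M N 1 e"
    using L by (auto simp: locally_free_quot_def)
  have "\<forall>f\<in>F. \<exists>e. basis_on (*s) f M N {..<1::nat} e"
    using F(3) by (simp only: basis_on_lessThan) blast
  from bchoice[OF this] obtain E where E: "\<And>f. f \<in> F \<Longrightarrow> basis_on (*s) f M N {..<1::nat} (E f)"
    by blast
  define e where "e f = E f 0" for f
  have eM: "e f \<in> M" if "f \<in> F" for f
    using basis_onD(1)[OF E[OF that], of 0] by (simp add: e_def)
  have e1: "\<exists>k c. f ^ k *s x - c *s e f \<in> N" if "f \<in> F" "x \<in> M" for f x
    using basis_onD(2)[OF E[OF that(1)] that(2)] by (auto simp: e_def)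
  \<comment> \<open>An ideal; \<open>1 \<in> ?Q\<close> yields one scalar for all local generators.\<close>
  let ?Q = "{b. \<exists>c. \<forall>x\<in>e ` F. b *s T x - c *s x \<in> N}"
  have "1 \<in> ?Q"
  proof (rule one_mem_ideal_if_radical[OF _ F(2)])
    show "ring.subspace ?Q"
    proof (rule ring.subspaceI)
      show "0 \<in> ?Q" using subspace_0[OF N] by (auto intro!: exI[of _ 0])
    next
      fix x y assume "x \<in> ?Q" "y \<in> ?Q"
      then obtain c d where *: "\<And>z. z \<in> e ` F \<Longrightarrow> x *s T z - c *s z \<in> N" "\<And>z. z \<in> e ` F \<Longrightarrow> y *s T z - d *s z \<in> N"
        by auto
      have "(x + y) *s T z - (c + d) *s z \<in> N" if "z \<in> e ` F" for z
        using subspace_add[OF N *(1)[OF that] *(2)[OF that]] by (simp add: scale_left_distrib algebra_simps)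
      then show "x + y \<in> ?Q" by blast
    next
      fix a x assume "x \<in> ?Q"
      then obtain c where *: "\<And>z. z \<in> e ` F \<Longrightarrow> x *s T z - c *s z \<in> N" by auto
      have "(a * x) *s T z - (a * c) *s z \<in> N" if "z \<in> e ` F" for z
        using subspace_scale[OF N *[OF that], of a] by (simp add: scale_right_diff_distrib)
      then show "a * x \<in> ?Q" by blast
    qed
  next
    fix f assume f: "f \<in> F"
    have "T (e f) \<in> M" using TM eM[OF f] by auto
    then obtain K c where c: "f ^ K *s T (e f) - c *s e f \<in> N" using e1[OF f] by blast
    obtain k b where b: "\<forall>x\<in>e ` F. f ^ k *s x - b x *s e f \<in> N"
      using uniform_multiple[OF N, of "e ` F" f "\<lambda>x. x" "e f"] F(1) e1[OF f] eM by blast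
    have "f ^ (K + k) *s T x - (f ^ k * c) *s x \<in> N" if "x \<in> e ` F" for x
    proof -
      have bx: "f ^ k *s x - b x *s e f \<in> N" using b that by blast
      then have "T (f ^ k *s x - b x *s e f) \<in> N" using TN by auto
      then have tx: "f ^ k *s T x - b x *s T (e f) \<in> N" by (simp add: T.diff T.scale)
      have "f ^ K *s (f ^ k *s T x - b x *s T (e f)) + b x *s (f ^ K *s T (e f) - c *s e f)
        + c *s (b x *s e f - f ^ k *s x) \<in> N"
        using tx c bx subspace_neg[OF N bx]
        by (intro subspace_add[OF N subspace_add[OF N]] subspace_scale[OF N]) simp_all
      then show ?thesis
        by (simp add: scale_right_diff_distrib power_add mult_ac)
    qed
    then show "\<exists>k. f ^ k \<in> ?Q" by blast
  qed
  then obtain a where a: "\<And>f. f \<in> F \<Longrightarrow> T (e f) - a *s e f \<in> N" by auto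
  have "T x - a *s x \<in> N" if x: "x \<in> M" for x
  proof (rule mem_if_locally_mem[OF N F(2)])
    fix f assume f: "f \<in> F"
    obtain k c where c: "f ^ k *s x - c *s e f \<in> N" using e1[OF f x] by blast
    then have "T (f ^ k *s x - c *s e f) \<in> N" using TN by auto
    then have "f ^ k *s T x - c *s T (e f) \<in> N" by (simp add: T.diff T.scale)
    then have "(f ^ k *s T x - c *s T (e f)) + c *s (T (e f) - a *s e f) + a *s (c *s e f - f ^ k *s x) \<in> N"
      using a[OF f] subspace_neg[OF N c]
      by (intro subspace_add[OF N subspace_add[OF N]] subspace_scale[OF N]) simp_all
    then have "f ^ k *s (T x - a *s x) \<in> N" by (simp add: scale_right_diff_distrib mult_ac)
    then show "\<exists>k. f ^ k *s (T x - a *s x) \<in> N" by blast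
  qed
  then show ?thesis by blast
qed

end

section \<open>Transport along isomorphisms, and quotients over a field\<close>

text \<open>
  \<open>T\<close> induces an isomorphism of \<open>M / N\<close> with \<open>M' / N'\<close>.
\<close>

lemma free_locus_transport:
  assumes T: "module_hom s s' T" and M: "module.subspace s M" and N': "module.subspace s' N'"
    and TM: "T ` M \<subseteq> M'" and onto: "\<And>y. y \<in> M' \<Longrightarrow> \<exists>x\<in>M. y - T x \<in> N'"
    and N: "N = {x\<in>M. T x \<in> N'}"
  shows "free_locus s M N r = free_locus s' M' N' r"
proof -
  interpret T: module_hom s s' T by (rule T)
  have sumM: "(\<Sum>i<r. s (b i) (e i)) \<in> M" if "\<And>i. i < r \<Longrightarrow> e i \<in> M" for b :: "nat \<Rightarrow> _" and e
    by (intro T.m1.subspace_sum[OF M] T.m1.subspace_scale[OF M]) (use that in auto)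
  have T_comb: "T (s (f ^ k) x - (\<Sum>i<r. s (b i) (e i))) = s' (f ^ k) (T x) - (\<Sum>i<r. s' (b i) (T (e i)))"
    for f k x and b :: "nat \<Rightarrow> _" and e
    by (simp add: T.diff T.sum T.scale)
  have "basis_away s' f M' N' r (T \<circ> e)" if e: "basis_away s f M N r e" for f e
    unfolding basis_away_def
  proof (intro conjI ballI allI impI)
    fix i assume "i < r" then show "(T \<circ> e) i \<in> M'" using e TM by (auto simp: basis_away_def)
  next
    fix y assume "y \<in> M'"
    then obtain x where x: "x \<in> M" "y - T x \<in> N'" using onto by blast
    then obtain k b where "s (f ^ k) x - (\<Sum>i<r. s (b i) (e i)) \<in> N"
      using e unfolding basis_away_def by blast
    then have "T (s (f ^ k) x - (\<Sum>i<r. s (b i) (e i))) \<in> N'" by (simp add: N)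
    from T.m2.subspace_add[OF N' T.m2.subspace_scale[OF N' x(2), of "f ^ k"] this]
    have "s' (f ^ k) y - (\<Sum>i<r. s' (b i) ((T \<circ> e) i)) \<in> N'"
      unfolding T_comb by (simp add: T.m2.scale_right_diff_distrib)
    then show "\<exists>k b. s' (f ^ k) y - (\<Sum>i<r. s' (b i) ((T \<circ> e) i)) \<in> N'" by blast
  next
    fix b i assume b: "(\<Sum>i<r. s' (b i) ((T \<circ> e) i)) \<in> N'" and i: "i < r"
    have "(\<Sum>i<r. s (b i) (e i)) \<in> M" using e by (intro sumM) (auto simp: basis_away_def)
    with b have "(\<Sum>i<r. s (b i) (e i)) \<in> N" by (simp add: N T.sum T.scale)
    with e i show "\<exists>k. f ^ k * b i = 0" unfolding basis_away_def by blast
  qed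
  moreover have "\<exists>e. basis_away s f M N r e" if e': "basis_away s' f M' N' r e'" for f e'
  proof -
    have "\<forall>i\<in>{..<r}. \<exists>x. x \<in> M \<and> e' i - T x \<in> N'"
      using e' onto unfolding basis_away_def by (metis lessThan_iff)
    from bchoice[OF this] obtain e where e: "\<And>i. i < r \<Longrightarrow> e i \<in> M" "\<And>i. i < r \<Longrightarrow> e' i - T (e i) \<in> N'"
      by blast
    have diff: "(\<Sum>i<r. s' (b i) (e' i)) - (\<Sum>i<r. s' (b i) (T (e i))) \<in> N'" for b :: "nat \<Rightarrow> _"
      unfolding sum_subtractf[symmetric] T.m2.scale_right_diff_distrib[symmetric]
      by (intro T.m2.subspace_sum[OF N'] T.m2.subspace_scale[OF N']) (use e in auto)
    have "basis_away s f M N r e"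
      unfolding basis_away_def
    proof (intro conjI ballI allI impI)
      fix x assume x: "x \<in> M"
      then obtain k b where "s' (f ^ k) (T x) - (\<Sum>i<r. s' (b i) (e' i)) \<in> N'"
        using e' TM unfolding basis_away_def by blast
      from T.m2.subspace_add[OF N' this diff[of b]]
      have "T (s (f ^ k) x - (\<Sum>i<r. s (b i) (e i))) \<in> N'" unfolding T_comb by simp
      moreover have "s (f ^ k) x - (\<Sum>i<r. s (b i) (e i)) \<in> M"
        by (intro T.m1.subspace_diff[OF M] T.m1.subspace_scale[OF M] x sumM e(1))
      ultimately show "\<exists>k b. s (f ^ k) x - (\<Sum>i<r. s (b i) (e i)) \<in> N" unfolding N by blast
    next
      fix b i assume "(\<Sum>i<r. s (b i) (e i)) \<in> N" and i: "i < r"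
      then have "(\<Sum>i<r. s' (b i) (T (e i))) \<in> N'" by (simp add: N T.sum T.scale)
      from T.m2.subspace_add[OF N' diff[of b] this] have "(\<Sum>i<r. s' (b i) (e' i)) \<in> N'" by simp
      with e' i show "\<exists>k. f ^ k * b i = 0" unfolding basis_away_def by blast
    qed (rule e)
    then show ?thesis by blast
  qed
  ultimately show ?thesis unfolding free_locus_def by blast
qed

lemma locally_free_transport:
  assumes "module_hom s s' T" "module.subspace s M" "module.subspace s' N'" "T ` M \<subseteq> M'"
    "\<And>y. y \<in> M' \<Longrightarrow> \<exists>x\<in>M. y - T x \<in> N'" "N = {x\<in>M. T x \<in> N'}"
  shows "locally_free_quot s M N r \<longleftrightarrow> locally_free_quot s' M' N' r"
  using free_locus_transport[OF assms] assms(1)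
  by (simp add: module.locally_free_iff module_hom_def)

lemma basis_on_one_if_unit:
  fixes s :: "'a::field \<Rightarrow> 'm::ab_group_add \<Rightarrow> 'm"
  assumes "module s" "module.subspace s N" "f \<noteq> 0" "basis_on s f M N A e"
  shows "basis_on s 1 M N A e"
  using module.basis_on_mult[OF assms(1,2,4), of "inverse f"] assms(3) by simp

lemma locally_free_imp_free_over_field:
  fixes s :: "'a::field \<Rightarrow> 'm::ab_group_add \<Rightarrow> 'm"
  assumes s: "module s" and N: "module.subspace s N" and L: "locally_free_quot s M N r"
  shows "free_quot s M N r"
proof -
  have "\<exists>f\<in>free_locus s M N r. f \<noteq> 0"
  proof (rule ccontr)
    assume "\<not> ?thesis"
    then have "ring.span (free_locus s M N r) \<subseteq> {0}" by (intro ring.span_minimal) auto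
    with L show False by (auto simp: module.locally_free_iff[OF s])
  qed
  then obtain f e where "f \<noteq> 0" "basis_on s f M N {..<r} e"
    by (auto simp: free_locus_def module.basis_on_lessThan[OF s])
  from basis_on_one_if_unit[OF s N this] show ?thesis
    unfolding free_quot_def module.basis_on_lessThan[OF s] by blast
qed

text \<open>
  A minimal spanning subset of the images of the basis elements is a basis of the quotient.
\<close>

lemma quotient_of_free_over_field:
  fixes s :: "'a::field \<Rightarrow> 'm::ab_group_add \<Rightarrow> 'm"
  assumes "module s" and sub: "module.subspace s W" "module.subspace s M" "N \<subseteq> M" "M \<subseteq> W"
    and free: "free_quot s W N n"
  shows "\<exists>m\<le>n. free_quot s W M m"
proof -
  interpret module s by (rule assms)
  note M = sub(2)
  obtain e where e: "basis_on s 1 W N {..<n} e" using free by (auto simp: free_quot_def basis_on_lessThan)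
  define P where "P S \<longleftrightarrow> S \<subseteq> {..<n} \<and> (\<forall>x\<in>W. \<exists>b. x - (\<Sum>i\<in>S. s (b i) (e i)) \<in> M)" for S
  have "P {..<n}" using basis_onD(2)[OF e] \<open>N \<subseteq> M\<close> unfolding P_def by fastforce
  from ex_has_least_nat[of P "{..<n}" card, OF this]
  obtain S where S: "P S" and least: "\<And>S'. P S' \<Longrightarrow> card S \<le> card S'" by blast
  have [simp]: "finite S" using S finite_subset by (auto simp: P_def)
  have "basis_on s 1 W M S e"
    unfolding basis_on_def
  proof (intro conjI ballI allI impI)
    fix i assume "i \<in> S" then show "e i \<in> W" using S basis_onD(1)[OF e] by (auto simp: P_def)
  next
    fix x assume "x \<in> W"
    then show "\<exists>k b. s (1 ^ k) x - (\<Sum>i\<in>S. s (b i) (e i)) \<in> M" using S by (simp add: P_def)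
  next
    fix b j assume b: "(\<Sum>i\<in>S. s (b i) (e i)) \<in> M" and j: "j \<in> S"
    have "b j = 0"
    proof (rule ccontr)
      assume bj: "b j \<noteq> 0"
      have "P (S - {j})"
        unfolding P_def
      proof (intro conjI ballI)
        show "S - {j} \<subseteq> {..<n}" using S by (auto simp: P_def)
        fix x assume "x \<in> W"
        then obtain c where c: "x - (\<Sum>i\<in>S. s (c i) (e i)) \<in> M" using S unfolding P_def by blast
        \<comment> \<open>The coefficient at \<open>j\<close> is chosen to cancel.\<close>
        let ?d = "\<lambda>i. c i - c j / b j * b i"
        have "x - (\<Sum>i\<in>S. s (c i) (e i)) + s (c j / b j) (\<Sum>i\<in>S. s (b i) (e i)) \<in> M"
          by (intro subspace_add[OF M] subspace_scale[OF M] b c)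
        also have "x - (\<Sum>i\<in>S. s (c i) (e i)) + s (c j / b j) (\<Sum>i\<in>S. s (b i) (e i))
          = x - (\<Sum>i\<in>S. s (?d i) (e i))"
          by (simp add: scale_left_diff_distrib scale_sum_right sum_subtractf)
        also have "(\<Sum>i\<in>S. s (?d i) (e i)) = (\<Sum>i\<in>S - {j}. s (?d i) (e i))"
          using bj by (subst sum.remove[OF _ j]) auto
        finally show "\<exists>b. x - (\<Sum>i\<in>S - {j}. s (b i) (e i)) \<in> M" by (intro exI[of _ ?d])
      qed
      from least[OF this] j show False using card_Diff1_less[OF \<open>finite S\<close> j] by simp
    qed
    then show "\<exists>k. 1 ^ k * b j = 0" by simp
  qed
  then have "1 \<in> free_locus s W M (card S)" by (intro free_locusI) auto
  moreover have "card S \<le> n" using S card_mono[of "{..<n}" S] by (simp add: P_def)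
  ultimately show ?thesis by (auto simp: free_locus_def free_quot_def)
qed

section \<open>Polynomials in two variables and maps on coefficients\<close>

interpretation psc: module "pscale :: 'a::comm_ring_1 \<Rightarrow> _"
  by (rule module_pscale)

lemma poly2_eqI: "(\<And>i j. coeff (coeff g i) j = coeff (coeff h i) j) \<Longrightarrow> g = h"
  by (intro poly_eqI) blast

lemma coeff2_pscale [simp]: "coeff (coeff (pscale b g) i) j = b * coeff (coeff g i) j"
  by (simp add: pscale_def)

lemma coeff2_base_change:
  "\<phi> 0 = 0 \<Longrightarrow> coeff (coeff (base_change \<phi> g) i) j = \<phi> (coeff (coeff g i) j)"
  by (simp add: base_change_def coeff_map_poly)

lemma pscale_mult_right: "g * pscale b h = pscale b (g * h)"
  by (simp add: pscale_eq_times mult_ac)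

text \<open>
  The constants and the two variables generate the polynomial ring.
\<close>

lemma poly2_induct [case_names const add x y]:
  fixes g :: "'a::comm_ring_1 poly poly"
  assumes const: "\<And>b. P [:[:b:]:]" and add: "\<And>g h. P g \<Longrightarrow> P h \<Longrightarrow> P (g + h)"
    and x: "\<And>g. P g \<Longrightarrow> P ([:[:0, 1:]:] * g)" and y: "\<And>g. P g \<Longrightarrow> P ([:0, 1:] * g)"
  shows "P g"
proof (induction g rule: pCons_induct)
  case 0
  show ?case using const[of 0] by simp
next
  case (pCons a g)
  have "P [:a:]"
  proof (induction a rule: pCons_induct)
    case 0
    show ?case using const[of 0] by simp
  next
    case (pCons b a)
    have "[:pCons b a:] = [:[:b:]:] + [:[:0, 1:]:] * [:a:]" by simp
    then show ?case using add[OF const[of b] x[OF pCons.IH]] by simp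
  qed
  have "pCons a g = [:a:] + [:0, 1:] * g" by simp
  then show ?case using add[OF \<open>P [:a:]\<close> y[OF pCons.IH]] by simp
qed

lemma eval2_simps [simp]:
  "eval2 q 0 = 0" "eval2 q 1 = 1" "eval2 q (g + h) = eval2 q g + eval2 q h" "eval2 q (g * h) = eval2 q g * eval2 q h"
  "eval2 q (g - h) = eval2 q g - eval2 q h" "eval2 q [:[:b:]:] = b" "eval2 q (pscale b g) = b * eval2 q g"
  by (simp_all add: eval2_def pscale_def)

lemma eval2_xy [simp]: "eval2 q [:[:0, 1:]:] = fst q" "eval2 q [:0, 1:] = snd q"
  by (simp_all add: eval2_def)

text \<open>
  Two kinds of maps are applied to the coefficients of polynomials: a ring homomorphism \<open>l\<close> (with \<open>k\<close>
  the identity and \<open>k' = l\<close>), and a \<open>\<complex>\<close>-linear functional \<open>l\<close> on a \<open>\<complex>\<close>-algebra (with \<open>k\<close> the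
  structure map and \<open>k'\<close> the identity). The locale covers both.
\<close>

locale semilinear =
  fixes k :: "'a::comm_ring_1 \<Rightarrow> 'b::comm_ring_1" and k' :: "'a \<Rightarrow> 'c::comm_ring_1" and l :: "'b \<Rightarrow> 'c"
  assumes k: "unital_ring_hom k" and k': "unital_ring_hom k'"
    and add: "l (a + b) = l a + l b" and scale: "l (k c * a) = k' c * l a"
begin

lemma zero [simp]: "l 0 = 0" using add[of 0 0] by simp

lemma hom_zero: "k 0 = 0" "k' 0 = 0"
  using k k' unfolding unital_ring_hom_def by (metis add_cancel_right_right)+

lemma hom_one: "k 1 = 1" "k' 1 = 1"
  using k k' unfolding unital_ring_hom_def by blast+

lemma l_add: "l (a + b) = l a + l b" by (rule add)

lemma l_sum: "l (sum f A) = (\<Sum>i\<in>A. l (f i))"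
  by (induction A rule: infinite_finite_induct) (simp_all add: add)

lemma map_poly_add: "map_poly l (p + q) = map_poly l p + map_poly l q"
  by (intro poly_eqI) (simp add: coeff_map_poly add)

lemma map_poly_sum: "map_poly l (sum f A) = (\<Sum>i\<in>A. map_poly l (f i))"
  by (induction A rule: infinite_finite_induct) (simp_all add: map_poly_add)

lemma map_poly_mult: "map_poly l (map_poly k p * q) = map_poly k' p * map_poly l q"
  by (intro poly_eqI) (simp add: coeff_map_poly coeff_mult l_sum scale hom_zero)

lemma base_change_zero [simp]: "base_change l 0 = 0"
  by (simp add: base_change_def)

lemma coeff2_l: "coeff (coeff (base_change l g) i) j = l (coeff (coeff g i) j)"
  by (simp add: coeff2_base_change)

lemma base_change_add: "base_change l (g + h) = base_change l g + base_change l h"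
  by (intro poly2_eqI) (simp add: coeff2_l add)

lemma base_change_diff: "base_change l (g - h) = base_change l g - base_change l h"
  using base_change_add[of "g - h" h] by simp

lemma base_change_sum: "base_change l (sum f A) = (\<Sum>i\<in>A. base_change l (f i))"
  by (induction A rule: infinite_finite_induct) (simp_all add: base_change_add)

lemma base_change_mult: "base_change l (base_change k g * h) = base_change k' g * base_change l h"
proof (rule poly_eqI)
  fix n
  have "map_poly l (\<Sum>i\<le>n. map_poly k (coeff g i) * coeff h (n - i))
    = (\<Sum>i\<le>n. map_poly k' (coeff g i) * map_poly l (coeff h (n - i)))"
    unfolding map_poly_sum by (simp add: map_poly_mult)
  then show "coeff (base_change l (base_change k g * h)) n = coeff (base_change k' g * base_change l h) n"
    by (simp add: base_change_def coeff_map_poly coeff_mult hom_zero)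
qed

lemma base_change_const: "base_change l [:[:b:]:] = [:[:l b:]:]"
  by (simp add: base_change_def map_poly_pCons hom_zero hom_one)

lemma base_change_pscale_hom: "base_change l (pscale (k c) g) = pscale (k' c) (base_change l g)"
  by (intro poly2_eqI) (simp add: coeff2_l scale)

lemma base_change_pscale_base_change: "base_change l (pscale b (base_change k g)) = pscale (l b) (base_change k' g)"
  by (intro poly2_eqI) (use scale in \<open>simp add: coeff2_base_change hom_zero mult.commute\<close>)

lemma base_change_xy:
  "base_change l ([:[:0, 1:]:] * g) = [:[:0, 1:]:] * base_change l g"
  "base_change l ([:0, 1:] * g) = [:0, 1:] * base_change l g"
  using base_change_mult[of "[:[:0, 1:]:]" g] base_change_mult[of "[:0, 1:]" g]
  by (simp_all add: base_change_def map_poly_pCons hom_zero hom_one)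

lemma eval2_base_change: "eval2 (map_prod k' k' q) (base_change l g) = l (eval2 (map_prod k k q) g)"
proof (induction g rule: poly2_induct)
  case (const b)
  show ?case by (simp add: base_change_const)
next
  case (add g h)
  then show ?case by (simp add: base_change_add l_add)
next
  case (x g)
  then show ?case by (simp only: base_change_xy eval2_simps eval2_xy fst_map_prod snd_map_prod scale)
next
  case (y g)
  then show ?case by (simp only: base_change_xy eval2_simps eval2_xy fst_map_prod snd_map_prod scale)
qed

end

lemma base_change_id: "base_change (\<lambda>c. c) g = g"
  by (intro poly2_eqI) (simp add: coeff2_base_change)

lemma semilinear_hom: "unital_ring_hom \<phi> \<Longrightarrow> semilinear (\<lambda>c. c) \<phi> \<phi>"
  by (simp add: semilinear_def unital_ring_hom_def)

section \<open>Scalar extension of complex subspaces\<close>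

abbreviation functional :: "(complex \<Rightarrow> 'b::comm_ring_1) \<Rightarrow> ('b \<Rightarrow> complex) \<Rightarrow> bool" where
  "functional \<iota> \<mu> \<equiv> semilinear \<iota> (\<lambda>c. c) \<mu>"

text \<open>
  The functionals on \<open>B\<close> form a \<open>B\<close>-module. This makes conditions that quantify over all functionals
  stable under scalars of \<open>B\<close>.
\<close>

lemma functional_rescale: "functional \<iota> \<mu> \<Longrightarrow> functional \<iota> (\<lambda>a. \<mu> (b * a))"
  by (simp add: semilinear_def distrib_left mult.left_commute[of b])

text \<open>
  A functional commutes with multiplication by complex polynomials and with evaluation at a complex
  point, so it carries statements about \<open>B[x,y] / I B[x,y]\<close> to statements about \<open>\<complex>[x,y] / I\<close>.
\<close>

lemma functional_base_change:
  assumes "functional \<iota> \<mu>"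
  shows "base_change \<mu> (base_change \<iota> g * h) = g * base_change \<mu> h"
    "base_change \<mu> (pscale b (base_change \<iota> g)) = pscale (\<mu> b) g"
    "eval2 q (base_change \<mu> h) = \<mu> (eval2 (map_prod \<iota> \<iota> q) h)"
proof -
  interpret semilinear \<iota> "\<lambda>c. c" \<mu> by (rule assms)
  have "map_prod (\<lambda>c. c) (\<lambda>c. c) q = q" by (cases q) simp
  then show "base_change \<mu> (base_change \<iota> g * h) = g * base_change \<mu> h"
    "base_change \<mu> (pscale b (base_change \<iota> g)) = pscale (\<mu> b) g"
    "eval2 q (base_change \<mu> h) = \<mu> (eval2 (map_prod \<iota> \<iota> q) h)"
    using base_change_mult[of g h] base_change_pscale_base_change[of b g] eval2_base_change[of q h]
    by (simp_all add: base_change_id)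
qed

text \<open>
  The coordinates with respect to a basis of \<open>B\<close> as a complex vector space; finitely many elements
  involve only finitely many basis vectors.
\<close>

lemma functionals_coordinates:
  fixes \<iota> :: "complex \<Rightarrow> 'b::comm_ring_1"
  assumes \<iota>: "unital_ring_hom \<iota>" and X: "finite X"
  shows "\<exists>T \<Lambda>. finite T \<and> (\<forall>w. functional \<iota> (\<Lambda> w)) \<and> (\<forall>b\<in>X. b = (\<Sum>w\<in>T. w * \<iota> (\<Lambda> w b)))"
proof -
  interpret V: vector_space "\<lambda>c (b::'b). \<iota> c * b"
    using \<iota> by unfold_locales (simp_all add: unital_ring_hom_def algebra_simps)
  let ?H = "V.extend_basis {}"
  have H: "V.independent ?H" and span: "b \<in> V.span ?H" for b
    using V.independent_extend_basis[OF V.independent_empty] V.span_extend_basis[OF V.independent_empty]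
    by simp_all
  define \<Lambda> where "\<Lambda> w b = V.representation ?H b w" for w b
  have "functional \<iota> (\<Lambda> w)" for w
    using \<iota> by (simp add: semilinear_def unital_ring_hom_def \<Lambda>_def V.representation_add[OF H span span]
        V.representation_scale[OF H span])
  define T where "T = (\<Union>b\<in>X. {w. \<Lambda> w b \<noteq> 0})"
  have fin: "finite {w. \<Lambda> w b \<noteq> 0}" for b unfolding \<Lambda>_def by (rule V.finite_representation)
  then have T: "finite T" unfolding T_def using X by blast
  have \<iota>0: "\<iota> 0 = 0" using \<iota> unfolding unital_ring_hom_def by (metis add_cancel_right_right)
  have "b = (\<Sum>w\<in>T. w * \<iota> (\<Lambda> w b))" if "b \<in> X" for b
  proof -
    have "b = (\<Sum>w | \<Lambda> w b \<noteq> 0. w * \<iota> (\<Lambda> w b))"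
      using V.sum_nonzero_representation_eq[OF H span, of b] by (simp add: \<Lambda>_def mult.commute)
    also have "\<dots> = (\<Sum>w\<in>T. w * \<iota> (\<Lambda> w b))"
      using T that \<iota>0 by (intro sum.mono_neutral_left) (auto simp: T_def)
    finally show ?thesis .
  qed
  with T \<open>\<And>w. functional \<iota> (\<Lambda> w)\<close> show ?thesis by blast
qed

lemma nonzero_functional:
  fixes \<iota> :: "complex \<Rightarrow> 'b::comm_ring_1"
  assumes \<iota>: "unital_ring_hom \<iota>" and b: "\<And>\<mu>. functional \<iota> \<mu> \<Longrightarrow> \<mu> b = 0"
  shows "b = 0"
proof -
  have \<iota>0: "\<iota> 0 = 0" using \<iota> unfolding unital_ring_hom_def by (metis add_cancel_right_right)
  obtain T \<Lambda> where "\<And>w. functional \<iota> (\<Lambda> w)" "b = (\<Sum>w\<in>T. w * \<iota> (\<Lambda> w b))"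
    using functionals_coordinates[OF \<iota>, of "{b}"] by auto
  moreover have "\<Lambda> w b = 0" for w using b calculation(1) by blast
  ultimately show ?thesis using \<iota>0 by simp
qed

lemma expansion_by_functionals:
  fixes g :: "'b::comm_ring_1 poly poly"
  assumes \<iota>: "unital_ring_hom \<iota>"
  shows "\<exists>T \<Lambda>. finite T \<and> (\<forall>w. functional \<iota> (\<Lambda> w)) \<and>
    g = (\<Sum>w\<in>T. pscale w (base_change \<iota> (base_change (\<Lambda> w) g)))"
proof -
  let ?X = "insert 0 (\<Union>p\<in>set (coeffs g). set (coeffs p))"
  obtain T \<Lambda> where T: "finite T" and \<Lambda>: "\<And>w. functional \<iota> (\<Lambda> w)"
    and X: "\<And>b. b \<in> ?X \<Longrightarrow> b = (\<Sum>w\<in>T. w * \<iota> (\<Lambda> w b))"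
    using functionals_coordinates[OF \<iota>, of ?X] by blast
  have coeff: "coeff (coeff g i) j \<in> ?X" for i j
  proof (cases "coeff (coeff g i) j = 0")
    case False
    then have "coeff g i \<noteq> 0" by auto
    with False show ?thesis
      using coeff_in_coeffs[of g i] coeff_in_coeffs[of "coeff g i" j]
      by (metis UN_I coeff_0 insert_iff le_degree)
  qed simp
  have "g = (\<Sum>w\<in>T. pscale w (base_change \<iota> (base_change (\<Lambda> w) g)))"
  proof (rule poly2_eqI)
    fix i j
    have "\<iota> 0 = 0" "\<Lambda> w 0 = 0" for w
      using semilinear.zero[OF \<Lambda>] semilinear.hom_zero(1)[OF \<Lambda>] by blast+
    then show "coeff (coeff g i) j
      = coeff (coeff (\<Sum>w\<in>T. pscale w (base_change \<iota> (base_change (\<Lambda> w) g))) i) j"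
      using X[OF coeff[of i j]] by (simp add: coeff_sum coeff2_base_change)
  qed
  with T \<Lambda> show ?thesis by blast
qed

text \<open>
  The image of \<open>W \<otimes> B\<close> in \<open>B[x,y]\<close>. For an ideal it agrees with \<open>pull_ideal\<close>, but it also makes sense
  for subspaces such as the numerators of the socle.
\<close>

definition extend_scalars :: "('a::comm_ring_1 \<Rightarrow> 'b::comm_ring_1) \<Rightarrow> 'a poly poly set \<Rightarrow> 'b poly poly set" where
  "extend_scalars \<iota> W = psc.span (base_change \<iota> ` W)"

lemma subspace_extend_scalars [simp]: "psc.subspace (extend_scalars \<iota> W)"
  by (simp add: extend_scalars_def)

lemma base_change_in_extend_scalars: "h \<in> W \<Longrightarrow> base_change \<iota> h \<in> extend_scalars \<iota> W"
  unfolding extend_scalars_def by (rule psc.span_base) simp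

lemma extend_scalars_mono: "V \<subseteq> W \<Longrightarrow> extend_scalars \<iota> V \<subseteq> extend_scalars \<iota> W"
  unfolding extend_scalars_def by (intro psc.span_mono image_mono)

lemma extend_scalars_minimal: "psc.subspace U \<Longrightarrow> (\<And>h. h \<in> W \<Longrightarrow> base_change \<iota> h \<in> U) \<Longrightarrow> extend_scalars \<iota> W \<subseteq> U"
  unfolding extend_scalars_def by (rule psc.span_minimal) auto

text \<open>
  Membership in a scalar extension can be tested on functionals. If all \<open>base_change \<mu> g\<close> lie in \<open>W\<close>,
  the expansion of \<open>g\<close> along a basis of \<open>B\<close> over \<open>\<complex>\<close> is a combination of elements of \<open>W\<close>.
\<close>

lemma mem_extend_scalars_iff:
  fixes \<iota> :: "complex \<Rightarrow> 'b::comm_ring_1"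
  assumes \<iota>: "unital_ring_hom \<iota>" and W: "psc.subspace W"
  shows "g \<in> extend_scalars \<iota> W \<longleftrightarrow> (\<forall>\<mu>. functional \<iota> \<mu> \<longrightarrow> base_change \<mu> g \<in> W)"
proof
  assume g: "\<forall>\<mu>. functional \<iota> \<mu> \<longrightarrow> base_change \<mu> g \<in> W"
  obtain T \<Lambda> where \<Lambda>: "\<And>w. functional \<iota> (\<Lambda> w)"
    and "g = (\<Sum>w\<in>T. pscale w (base_change \<iota> (base_change (\<Lambda> w) g)))"
    using expansion_by_functionals[OF \<iota>, of g] by blast
  moreover have "(\<Sum>w\<in>T. pscale w (base_change \<iota> (base_change (\<Lambda> w) g))) \<in> extend_scalars \<iota> W"
    by (intro psc.subspace_sum psc.subspace_scale base_change_in_extend_scalars) (use g \<Lambda> in auto)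
  ultimately show "g \<in> extend_scalars \<iota> W" by simp
next
  let ?U = "{g. \<forall>\<mu>. functional \<iota> \<mu> \<longrightarrow> base_change \<mu> g \<in> W}"
  have "extend_scalars \<iota> W \<subseteq> ?U"
  proof (rule extend_scalars_minimal)
    show "psc.subspace ?U"
    proof (rule psc.subspaceI)
      show "0 \<in> ?U" using psc.subspace_0[OF W] by (auto simp: semilinear.base_change_zero)
      show "g + h \<in> ?U" if "g \<in> ?U" "h \<in> ?U" for g h
        using that psc.subspace_add[OF W] by (auto simp: semilinear.base_change_add)
      show "pscale b g \<in> ?U" if g: "g \<in> ?U" for b g
      proof (intro CollectI allI impI)
        fix \<mu> assume \<mu>: "functional \<iota> \<mu>"
        have "base_change \<mu> (pscale b g) = base_change (\<lambda>a. \<mu> (b * a)) g"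
          using semilinear.zero[OF \<mu>] by (intro poly2_eqI) (simp add: coeff2_base_change)
        with g functional_rescale[OF \<mu>, of b] show "base_change \<mu> (pscale b g) \<in> W" by simp
      qed
    qed
    fix h assume h: "h \<in> W"
    show "base_change \<iota> h \<in> ?U"
    proof (intro CollectI allI impI)
      fix \<mu> assume "functional \<iota> \<mu>"
      from functional_base_change(2)[OF this, of 1 h] psc.subspace_scale[OF W h]
      show "base_change \<mu> (base_change \<iota> h) \<in> W" by simp
    qed
  qed
  moreover assume "g \<in> extend_scalars \<iota> W"
  ultimately show "\<forall>\<mu>. functional \<iota> \<mu> \<longrightarrow> base_change \<mu> g \<in> W" by blast
qed

lemma extend_scalars_UNIV: "unital_ring_hom (\<iota> :: complex \<Rightarrow> 'b::comm_ring_1) \<Longrightarrow> extend_scalars \<iota> UNIV = UNIV"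
  using mem_extend_scalars_iff[of \<iota> UNIV] by auto

lemma base_change_linear:
  assumes "unital_ring_hom \<phi>"
  shows "base_change \<phi> (\<Sum>i\<in>A. pscale (c i) (e i)) = (\<Sum>i\<in>A. pscale (\<phi> (c i)) (base_change \<phi> (e i)))"
proof -
  interpret semilinear "\<lambda>c. c" \<phi> \<phi> by (rule semilinear_hom[OF assms])
  show ?thesis by (simp add: base_change_sum base_change_pscale_hom)
qed

text \<open>
  Spanning is inherited by linearity. A relation over \<open>B\<close> between the basis elements is sent by each
  functional to a relation over \<open>\<complex>\<close>, so all functionals vanish on its coefficients.
\<close>

lemma basis_extend_scalars:
  fixes \<iota> :: "complex \<Rightarrow> 'b::comm_ring_1"
  assumes \<iota>: "unital_ring_hom \<iota>" and N: "psc.subspace N" and e: "basis_away pscale 1 M N r e"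
  shows "basis_away pscale 1 (extend_scalars \<iota> M) (extend_scalars \<iota> N) r (\<lambda>i. base_change \<iota> (e i))"
proof -
  have e': "basis_on pscale 1 M N {..<r} e" using e by (simp add: psc.basis_on_lessThan)
  have e1: "\<exists>c. h - (\<Sum>i<r. pscale (c i) (e i)) \<in> N" if "h \<in> M" for h
    using e that by (auto simp: basis_away_def)
  interpret \<iota>: semilinear "\<lambda>c. c" \<iota> \<iota> by (rule semilinear_hom[OF \<iota>])
  let ?s = "\<lambda>b. \<Sum>i<r. pscale (b i) (base_change \<iota> (e i))"
  let ?U = "{g. \<exists>b. g - ?s b \<in> extend_scalars \<iota> N}"
  have "extend_scalars \<iota> M \<subseteq> ?U"
  proof (rule extend_scalars_minimal)
    show "psc.subspace ?U"
    proof (rule psc.subspaceI)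
      show "0 \<in> ?U"
        by (auto intro!: exI[of _ "\<lambda>_. 0"] simp: psc.subspace_0)
    next
      fix g h assume "g \<in> ?U" "h \<in> ?U"
      then obtain b c where "g - ?s b \<in> extend_scalars \<iota> N" "h - ?s c \<in> extend_scalars \<iota> N" by blast
      from psc.subspace_add[OF subspace_extend_scalars this]
      have "(g + h) - ?s (\<lambda>i. b i + c i) \<in> extend_scalars \<iota> N"
        by (simp add: psc.scale_left_distrib sum.distrib algebra_simps)
      then show "g + h \<in> ?U" by (intro CollectI exI[of _ "\<lambda>i. b i + c i"])
    next
      fix a g assume "g \<in> ?U"
      then obtain b where "g - ?s b \<in> extend_scalars \<iota> N" by blast
      from psc.subspace_scale[OF subspace_extend_scalars this, of a]
      have "pscale a g - ?s (\<lambda>i. a * b i) \<in> extend_scalars \<iota> N"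
        by (simp add: psc.scale_right_diff_distrib psc.scale_sum_right)
      then show "pscale a g \<in> ?U" by (intro CollectI exI[of _ "\<lambda>i. a * b i"])
    qed
    fix h assume "h \<in> M"
    then obtain c where "h - (\<Sum>i<r. pscale (c i) (e i)) \<in> N" using e1 by blast
    then have "base_change \<iota> (h - (\<Sum>i<r. pscale (c i) (e i))) \<in> extend_scalars \<iota> N" by (rule base_change_in_extend_scalars)
    then have "base_change \<iota> h - ?s (\<lambda>i. \<iota> (c i)) \<in> extend_scalars \<iota> N"
      by (simp add: \<iota>.base_change_diff base_change_linear[OF \<iota>])
    then show "base_change \<iota> h \<in> ?U" by (intro CollectI exI[of _ "\<lambda>i. \<iota> (c i)"])
  qed
  moreover have "b i = 0" if b: "?s b \<in> extend_scalars \<iota> N" and i: "i < r" for b i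
  proof (rule nonzero_functional[OF \<iota>])
    fix \<mu> assume \<mu>: "functional \<iota> \<mu>"
    have "base_change \<mu> (?s b) \<in> N" using b \<mu> by (simp add: mem_extend_scalars_iff[OF \<iota> N])
    then have "(\<Sum>i<r. pscale (\<mu> (b i)) (e i)) \<in> N"
      by (simp add: semilinear.base_change_sum[OF \<mu>] functional_base_change(2)[OF \<mu>])
    note s = this
    have "i \<in> {..<r}" using i by simp
    have "\<exists>k. 1 ^ k * \<mu> (b i) = 0"
      by (rule psc.basis_onD(3)[OF e', where b = "\<lambda>i. \<mu> (b i)"]) fact+
    then show "\<mu> (b i) = 0" by (metis mult_1 power_one)
  qed
  moreover have "\<forall>i<r. base_change \<iota> (e i) \<in> extend_scalars \<iota> M"
    using e by (simp add: basis_away_def base_change_in_extend_scalars)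
  ultimately show ?thesis unfolding basis_away_def by (simp add: subset_eq)
qed

lemma free_extend_scalars:
  assumes "unital_ring_hom \<iota>" "psc.subspace N" "free_quot pscale M N r"
  shows "free_quot pscale (extend_scalars \<iota> M) (extend_scalars (\<iota> :: complex \<Rightarrow> 'b::comm_ring_1) N) r"
  using basis_extend_scalars[OF assms(1,2)] assms(3) unfolding free_quot_def by blast

lemma psc_subspace_ideal:
  assumes J: "ring.subspace J"
  shows "psc.subspace J"
proof (rule psc.subspaceI)
  show "0 \<in> J" by (rule ring.subspace_0[OF J])
  show "g + h \<in> J" if "g \<in> J" "h \<in> J" for g h by (rule ring.subspace_add[OF J that])
  show "pscale b g \<in> J" if "g \<in> J" for b g
    unfolding pscale_eq_times by (rule ring.subspace_scale[OF J that])
qed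

lemma idealI_xy:
  assumes J: "psc.subspace J"
    and x: "\<And>j. j \<in> J \<Longrightarrow> [:[:0, 1:]:] * j \<in> J" and y: "\<And>j. j \<in> J \<Longrightarrow> [:0, 1:] * j \<in> J"
  shows "ring.subspace J"
proof (rule ring.subspaceI)
  show "0 \<in> J" by (rule psc.subspace_0[OF J])
  show "g + h \<in> J" if "g \<in> J" "h \<in> J" for g h using psc.subspace_add[OF J that] .
  fix g j assume "j \<in> J"
  then show "g * j \<in> J"
  proof (induction g arbitrary: j rule: poly2_induct)
    case (const b)
    then show ?case using psc.subspace_scale[OF J, of j b] by (simp only: pscale_eq_times)
  next
    case (add g h)
    then show ?case using psc.subspace_add[OF J] by (simp add: distrib_right)
  next
    case (x g)
    then show ?case using assms(2) by (simp only: mult.assoc)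
  next
    case (y g)
    then show ?case using assms(3) by (simp only: mult.assoc)
  qed
qed

text \<open>
  The \<open>B\<close>-span of the image of an ideal is already stable under \<open>x\<close> and \<open>y\<close>, hence an ideal.
\<close>

lemma pull_ideal_eq_extend_scalars:
  assumes \<phi>: "unital_ring_hom \<phi>" and J: "ring.subspace J"
  shows "pull_ideal \<phi> J = extend_scalars \<phi> J"
proof
  interpret \<phi>: semilinear "\<lambda>c. c" \<phi> \<phi> by (rule semilinear_hom[OF \<phi>])
  show "extend_scalars \<phi> J \<subseteq> pull_ideal \<phi> J"
    unfolding pull_ideal_def by (intro extend_scalars_minimal psc_subspace_ideal) (auto intro: ring.span_base)
  have closed: "base_change \<phi> u * g \<in> extend_scalars \<phi> J" if "g \<in> extend_scalars \<phi> J" for u g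
  proof -
    have "extend_scalars \<phi> J \<subseteq> {g. base_change \<phi> u * g \<in> extend_scalars \<phi> J}"
    proof (rule extend_scalars_minimal)
      show "psc.subspace {g. base_change \<phi> u * g \<in> extend_scalars \<phi> J}"
        by (rule psc.subspaceI) (simp_all add: psc.subspace_0 distrib_left psc.subspace_add
            pscale_mult_right psc.subspace_scale)
      fix h assume "h \<in> J"
      then have "u * h \<in> J" by (rule ring.subspace_scale[OF J])
      then show "base_change \<phi> h \<in> {g. base_change \<phi> u * g \<in> extend_scalars \<phi> J}"
        using base_change_in_extend_scalars[of "u * h" J \<phi>] \<phi>.base_change_mult
        by (simp add: base_change_id)
    qed
    with that show ?thesis by blast
  qed
  have "base_change \<phi> [:[:0, 1:]:] = [:[:0, 1:]:]" "base_change \<phi> [:0, 1:] = [:0, 1:]"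
    using \<phi> by (simp_all add: base_change_def map_poly_pCons unital_ring_hom_def)
  note xy = this
  have "ring.subspace (extend_scalars \<phi> J)"
    using closed[of _ "[:[:0, 1:]:]"] closed[of _ "[:0, 1:]"] unfolding xy
    by (intro idealI_xy subspace_extend_scalars)
  then show "pull_ideal \<phi> J \<subseteq> extend_scalars \<phi> J"
    unfolding pull_ideal_def by (intro ring.span_minimal) (auto intro: base_change_in_extend_scalars)
qed

section \<open>The residual point and the socle\<close>

text \<open>
  The coordinates of the residual point are the scalars by which \<open>x\<close> and \<open>y\<close> act on the line \<open>J / I\<close>.
  They are unique because a line is a faithful module, and they determine the action of every
  polynomial.
\<close>

lemma residual_point_unique_exists:
  fixes I J :: "'b::comm_ring_1 poly poly set"
  assumes I: "ring.subspace I" and J: "ring.subspace J" and IJ: "I \<subseteq> J"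
    and L: "locally_free_quot pscale J I 1"
  shows "\<exists>!q. \<forall>g. \<forall>j\<in>J. g * j - pscale (eval2 q g) j \<in> I"
proof -
  note pI = psc_subspace_ideal[OF I] and pJ = psc_subspace_ideal[OF J]
  have scalar: "\<exists>a. \<forall>j\<in>J. u * j - pscale a j \<in> I" for u
  proof (rule psc.endomorphism_of_line_is_scalar[OF pJ pI IJ L])
    show "module_hom pscale pscale ((*) u)"
      by (intro module_hom.intro module_pscale module_hom_axioms.intro)
        (simp_all add: distrib_left pscale_mult_right)
  qed (use ring.subspace_scale[OF I] ring.subspace_scale[OF J] in auto)
  obtain a b where a: "\<And>j. j \<in> J \<Longrightarrow> [:[:0, 1:]:] * j - pscale a j \<in> I"
    and b: "\<And>j. j \<in> J \<Longrightarrow> [:0, 1:] * j - pscale b j \<in> I"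
    using scalar by metis
  show ?thesis
  proof (rule ex1I[of _ "(a, b)"])
    have "\<forall>j\<in>J. g * j - pscale (eval2 (a, b) g) j \<in> I" for g
    proof (induction g rule: poly2_induct)
      case (const c)
      have "[:[:c:]:] * j - pscale (eval2 (a, b) [:[:c:]:]) j = 0" for j
        unfolding eval2_simps pscale_eq_times by (rule diff_self)
      then show ?case using psc.subspace_0[OF pI] by metis
    next
      case (add g h)
      show ?case
      proof
        fix j assume "j \<in> J"
        with add psc.subspace_add[OF pI]
        have "(g * j - pscale (eval2 (a, b) g) j) + (h * j - pscale (eval2 (a, b) h) j) \<in> I" by blast
        then show "(g + h) * j - pscale (eval2 (a, b) (g + h)) j \<in> I"
          by (simp add: algebra_simps psc.scale_left_distrib)
      qed
    next
      case (x g)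
      show ?case
      proof
        fix j assume j: "j \<in> J"
        have "g * ([:[:0, 1:]:] * j - pscale a j) + pscale a (g * j - pscale (eval2 (a, b) g) j) \<in> I"
          using x j by (intro psc.subspace_add[OF pI] psc.subspace_scale[OF pI] ring.subspace_scale[OF I] a) auto
        also have "g * ([:[:0, 1:]:] * j - pscale a j) + pscale a (g * j - pscale (eval2 (a, b) g) j)
          = [:[:0, 1:]:] * g * j - pscale (eval2 (a, b) ([:[:0, 1:]:] * g)) j"
          unfolding eval2_simps eval2_xy fst_conv right_diff_distrib psc.scale_right_diff_distrib
          by (simp only: pscale_mult_right psc.scale_scale diff_add_cancel mult.assoc mult.left_commute[of g]
              add_diff_eq)
        finally show "[:[:0, 1:]:] * g * j - pscale (eval2 (a, b) ([:[:0, 1:]:] * g)) j \<in> I" .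
      qed
    next
      case (y g)
      show ?case
      proof
        fix j assume j: "j \<in> J"
        have "g * ([:0, 1:] * j - pscale b j) + pscale b (g * j - pscale (eval2 (a, b) g) j) \<in> I"
          using y j by (intro psc.subspace_add[OF pI] psc.subspace_scale[OF pI] ring.subspace_scale[OF I] b) auto
        also have "g * ([:0, 1:] * j - pscale b j) + pscale b (g * j - pscale (eval2 (a, b) g) j)
          = [:0, 1:] * g * j - pscale (eval2 (a, b) ([:0, 1:] * g)) j"
          unfolding eval2_simps eval2_xy snd_conv right_diff_distrib psc.scale_right_diff_distrib
          by (simp only: pscale_mult_right psc.scale_scale diff_add_cancel mult.assoc mult.left_commute[of g]
              add_diff_eq)
        finally show "[:0, 1:] * g * j - pscale (eval2 (a, b) ([:0, 1:] * g)) j \<in> I" .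
      qed
    qed
    then show "\<forall>g. \<forall>j\<in>J. g * j - pscale (eval2 (a, b) g) j \<in> I" by blast
  next
    fix q assume q: "\<forall>g. \<forall>j\<in>J. g * j - pscale (eval2 q g) j \<in> I"
    have eq: "c = d" if c: "\<And>j. j \<in> J \<Longrightarrow> u * j - pscale c j \<in> I"
      and d: "\<And>j. j \<in> J \<Longrightarrow> u * j - pscale d j \<in> I" for u c d
    proof -
      have "pscale (c - d) j \<in> I" if "j \<in> J" for j
        using psc.subspace_diff[OF pI d[OF that] c[OF that]] by (simp add: psc.scale_left_diff_distrib)
      from psc.scalar_eq_0_if_kills_line[OF pI L this] show ?thesis by simp
    qed
    have "fst q = a"
    proof (rule eq[OF _ a])
      show "[:[:0, 1:]:] * j - pscale (fst q) j \<in> I" if "j \<in> J" for j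
        using q[rule_format, OF that, of "[:[:0, 1:]:]"] unfolding eval2_xy .
    qed
    moreover have "snd q = b"
    proof (rule eq[OF _ b])
      show "[:0, 1:] * j - pscale (snd q) j \<in> I" if "j \<in> J" for j
        using q[rule_format, OF that, of "[:0, 1:]"] unfolding eval2_xy .
    qed
    ultimately show "q = (a, b)" by auto
  qed
qed

lemma nested_hilbD:
  assumes "(I, J) \<in> nested_hilb n"
  shows "ring.subspace I" "ring.subspace J" "I \<subseteq> J" "locally_free_quot pscale UNIV J n"
    "locally_free_quot pscale J I 1"
proof -
  show *: "ring.subspace I" "ring.subspace J" "I \<subseteq> J" "locally_free_quot pscale UNIV J n"
    using assms by (auto simp: nested_hilb_def hilb_def)
  have "locally_free_quot pscale UNIV I (n + 1)" using assms by (simp add: nested_hilb_def hilb_def)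
  then show "locally_free_quot pscale J I 1"
    using * by (intro psc.locally_free_kernel[of UNIV I J n 1]) (auto intro: psc_subspace_ideal)
qed

lemma res_eq_iff:
  assumes "(I, J) \<in> nested_hilb n"
  shows "res I J = q \<longleftrightarrow> (\<forall>g. \<forall>j\<in>J. g * j - pscale (eval2 q g) j \<in> I)"
proof -
  note N = nested_hilbD[OF assms]
  note ex1 = residual_point_unique_exists[OF N(1,2,3,5)]
  show ?thesis
    unfolding res_def by (rule iffI, use theI'[OF ex1] in blast, rule the1_equality[OF ex1])
qed

lemma subset_soc_num: "ring.subspace I \<Longrightarrow> I \<subseteq> soc_num I p"
  using ring.subspace_scale[of I] by (auto simp: soc_num_def)

lemma subspace_soc_num:
  assumes I: "ring.subspace I"
  shows "psc.subspace (soc_num I p)"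
proof (rule psc.subspaceI)
  note pI = psc_subspace_ideal[OF I]
  show "0 \<in> soc_num I p" using psc.subspace_0[OF pI] by (simp add: soc_num_def)
  show "g + h \<in> soc_num I p" if "g \<in> soc_num I p" "h \<in> soc_num I p" for g h
    using that psc.subspace_add[OF pI] by (simp add: soc_num_def distrib_left)
  show "pscale c h \<in> soc_num I p" if "h \<in> soc_num I p" for c h
    using that psc.subspace_scale[OF pI] by (simp add: soc_num_def pscale_mult_right)
qed

text \<open>
  The elements of \<open>B[x,y] / I B[x,y]\<close> on which \<open>B[x,y]\<close> acts through \<open>p\<close> are the scalar extension of
  the socle. Both directions are checked on functionals: they turn the condition for \<open>B\<close> into the
  defining condition of \<open>soc_num I p\<close>.
\<close>

lemma mem_extend_scalars_soc_iff:
  fixes \<iota> :: "complex \<Rightarrow> 'b::comm_ring_1"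
  assumes \<iota>: "unital_ring_hom \<iota>" and I: "ring.subspace I"
  shows "u \<in> extend_scalars \<iota> (soc_num I p) \<longleftrightarrow> (\<forall>g. g * u - pscale (eval2 (map_prod \<iota> \<iota> p) g) u \<in> extend_scalars \<iota> I)"
proof
  assume u: "\<forall>g. g * u - pscale (eval2 (map_prod \<iota> \<iota> p) g) u \<in> extend_scalars \<iota> I"
  interpret \<iota>: semilinear "\<lambda>c. c" \<iota> \<iota> by (rule semilinear_hom[OF \<iota>])
  show "u \<in> extend_scalars \<iota> (soc_num I p)"
    unfolding mem_extend_scalars_iff[OF \<iota> subspace_soc_num[OF I]]
  proof (intro allI impI)
    fix \<mu> assume \<mu>: "functional \<iota> \<mu>"
    have "g * base_change \<mu> u \<in> I" if g: "g \<in> max_ideal p" for g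
    proof -
      have id: "map_prod (\<lambda>c. c) (\<lambda>c. c) p = p" by (cases p) simp
      have "eval2 (map_prod \<iota> \<iota> p) (base_change \<iota> g) = 0"
        using \<iota>.eval2_base_change[of p g] g by (simp add: max_ideal_def id)
      with u have "base_change \<iota> g * u \<in> extend_scalars \<iota> I"
        by (metis diff_zero psc.scale_zero_left)
      then have "base_change \<mu> (base_change \<iota> g * u) \<in> I"
        using \<mu> by (simp add: mem_extend_scalars_iff[OF \<iota> psc_subspace_ideal[OF I]])
      then show ?thesis by (simp add: functional_base_change(1)[OF \<mu>])
    qed
    then show "base_change \<mu> u \<in> soc_num I p" by (simp add: soc_num_def)
  qed
next
  let ?q = "map_prod \<iota> \<iota> p"
  let ?U = "{u. \<forall>g. g * u - pscale (eval2 ?q g) u \<in> extend_scalars \<iota> I}"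
  have "extend_scalars \<iota> (soc_num I p) \<subseteq> ?U"
  proof (rule extend_scalars_minimal)
    show "psc.subspace ?U"
    proof (rule psc.subspaceI)
      show "0 \<in> ?U" by (simp add: psc.subspace_0)
    next
      fix u v assume uv: "u \<in> ?U" "v \<in> ?U"
      have "(g * u - pscale (eval2 ?q g) u) + (g * v - pscale (eval2 ?q g) v) \<in> extend_scalars \<iota> I" for g
        using uv by (intro psc.subspace_add) auto
      then show "u + v \<in> ?U" by (simp add: algebra_simps psc.scale_right_distrib)
    next
      fix c u assume u: "u \<in> ?U"
      have "pscale c (g * u - pscale (eval2 ?q g) u) \<in> extend_scalars \<iota> I" for g
        using u by (intro psc.subspace_scale) auto
      then show "pscale c u \<in> ?U"
        by (simp add: psc.scale_right_diff_distrib pscale_mult_right mult.commute)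
    qed
    fix h assume h: "h \<in> soc_num I p"
    have "g * base_change \<iota> h - pscale (eval2 ?q g) (base_change \<iota> h) \<in> extend_scalars \<iota> I" for g
      unfolding mem_extend_scalars_iff[OF \<iota> psc_subspace_ideal[OF I]]
    proof (intro allI impI)
      fix \<mu> assume \<mu>: "functional \<iota> \<mu>"
      let ?g = "base_change \<mu> g"
      have "base_change \<mu> (g * base_change \<iota> h - pscale (eval2 ?q g) (base_change \<iota> h))
        = ?g * h - pscale (eval2 p ?g) h"
        using functional_base_change(1)[OF \<mu>, of h g]
        by (simp add: semilinear.base_change_diff[OF \<mu>] functional_base_change(2,3)[OF \<mu>] mult.commute)
      also have "\<dots> = (?g - [:[:eval2 p ?g:]:]) * h"
        by (simp only: left_diff_distrib pscale_eq_times)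
      also have "\<dots> \<in> I"
        using h by (simp add: soc_num_def max_ideal_def)
      finally show "base_change \<mu> (g * base_change \<iota> h - pscale (eval2 ?q g) (base_change \<iota> h)) \<in> I" .
    qed
    then show "base_change \<iota> h \<in> ?U" by simp
  qed
  moreover assume "u \<in> extend_scalars \<iota> (soc_num I p)"
  ultimately show "\<forall>g. g * u - pscale (eval2 ?q g) u \<in> extend_scalars \<iota> I" by blast
qed

section \<open>The tensor product with the socle\<close>

lemma lookup_map_hom: "\<phi> 0 = 0 \<Longrightarrow> Poly_Mapping.lookup (Poly_Mapping.map \<phi> t) v = \<phi> (Poly_Mapping.lookup t v)"
  by (simp add: Poly_Mapping.map.rep_eq when_def)

lemma lookup_fscale [simp]: "Poly_Mapping.lookup (fscale b t) v = b * Poly_Mapping.lookup t v"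
  by (simp add: fscale_def lookup_map_hom)

lemma module_fscale: "module (fscale :: 'b::comm_ring_1 \<Rightarrow> _)"
  by (unfold_locales; intro poly_mapping_eqI; simp add: lookup_add algebra_simps)

interpretation fsc: module "fscale :: 'b::comm_ring_1 \<Rightarrow> ('v \<Rightarrow>\<^sub>0 'b) \<Rightarrow> _"
  by (rule module_fscale)

lemma fscale_single: "fscale b (Poly_Mapping.single v c) = Poly_Mapping.single v (b * c)"
  by (intro poly_mapping_eqI) (simp add: lookup_single when_def)

lemma keys_fscale: "Poly_Mapping.keys (fscale b t) \<subseteq> Poly_Mapping.keys t"
  by (auto simp: in_keys_iff)

lemma subspace_free_on: "fsc.subspace (free_on E :: ('v \<Rightarrow>\<^sub>0 'b::comm_ring_1) set)"
proof (rule fsc.subspaceI)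
  show "0 \<in> free_on E" by (simp add: free_on_def)
  show "t + u \<in> free_on E" if "t \<in> free_on E" "u \<in> free_on E" for t u :: "'v \<Rightarrow>\<^sub>0 'b"
    using that Poly_Mapping.keys_add[of t u] unfolding free_on_def by blast
  show "fscale b t \<in> free_on E" if "t \<in> free_on E" for b and t :: "'v \<Rightarrow>\<^sub>0 'b"
    using that keys_fscale[of b t] unfolding free_on_def by blast
qed

lemma single_in_free_on: "v \<in> E \<Longrightarrow> Poly_Mapping.single v b \<in> free_on E"
  by (simp add: free_on_def)

lemma free_on_expansion:
  "t = (\<Sum>v\<in>Poly_Mapping.keys t. fscale (Poly_Mapping.lookup t v) (Poly_Mapping.single v 1))"
  by (intro poly_mapping_eqI)
    (simp add: fscale_single lookup_sum lookup_single when_def in_keys_iff)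

lemma free_on_minimal:
  fixes U :: "('v \<Rightarrow>\<^sub>0 'b::comm_ring_1) set"
  assumes "fsc.subspace U" "\<And>v. v \<in> E \<Longrightarrow> Poly_Mapping.single v 1 \<in> U"
  shows "free_on E \<subseteq> U"
proof
  fix t :: "'v \<Rightarrow>\<^sub>0 'b" assume "t \<in> free_on E"
  then have "(\<Sum>v\<in>Poly_Mapping.keys t. fscale (Poly_Mapping.lookup t v) (Poly_Mapping.single v 1)) \<in> U"
    using assms by (intro fsc.subspace_sum fsc.subspace_scale) (auto simp: free_on_def)
  then show "t \<in> U" by (simp only: free_on_expansion[symmetric])
qed

lemma tensor_eval_superset:
  assumes "finite A" "Poly_Mapping.keys t \<subseteq> A"
  shows "tensor_eval \<iota> t = (\<Sum>h\<in>A. pscale (Poly_Mapping.lookup t h) (base_change \<iota> h))"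
  unfolding tensor_eval_def using assms by (intro sum.mono_neutral_left) (auto simp: in_keys_iff)

lemma module_hom_tensor_eval: "module_hom fscale pscale (tensor_eval \<iota>)"
proof (intro module_hom.intro module_pscale module_fscale module_hom_axioms.intro)
  fix t u :: "complex poly poly \<Rightarrow>\<^sub>0 'a" and b
  let ?A = "Poly_Mapping.keys t \<union> Poly_Mapping.keys u"
  show "tensor_eval \<iota> (t + u) = tensor_eval \<iota> t + tensor_eval \<iota> u"
    using Poly_Mapping.keys_add[of t u]
    by (simp add: tensor_eval_superset[of ?A] lookup_add psc.scale_left_distrib sum.distrib)
  show "tensor_eval \<iota> (fscale b t) = pscale b (tensor_eval \<iota> t)"
    using keys_fscale[of b t]
    by (simp add: tensor_eval_superset[of "Poly_Mapping.keys t"] psc.scale_sum_right)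
qed

lemma tensor_eval_single: "tensor_eval \<iota> (Poly_Mapping.single h b) = pscale b (base_change \<iota> h)"
  by (simp add: tensor_eval_superset[of "{h}"])

lemma tensor_eval_free_on: "tensor_eval \<iota> ` free_on E = extend_scalars \<iota> E"
proof
  interpret te: module_hom fscale pscale "tensor_eval \<iota>" by (rule module_hom_tensor_eval)
  show "extend_scalars \<iota> E \<subseteq> tensor_eval \<iota> ` free_on E"
  proof (rule extend_scalars_minimal)
    show "psc.subspace (tensor_eval \<iota> ` free_on E)"
      by (rule te.subspace_image[OF subspace_free_on])
    fix h assume "h \<in> E"
    then show "base_change \<iota> h \<in> tensor_eval \<iota> ` free_on E"
      using tensor_eval_single[of \<iota> h 1] single_in_free_on by (metis image_eqI psc.scale_one)
  qed
  have "free_on E \<subseteq> {t. tensor_eval \<iota> t \<in> extend_scalars \<iota> E}"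
    by (rule free_on_minimal[OF te.subspace_vimage[OF subspace_extend_scalars, unfolded vimage_def]])
      (simp add: tensor_eval_single base_change_in_extend_scalars)
  then show "tensor_eval \<iota> ` free_on E \<subseteq> extend_scalars \<iota> E" by blast
qed

text \<open>
  Injectivity of \<open>(E / K) \<otimes> B \<rightarrow> B[x,y] / K B[x,y]\<close>. Modulo the relations of the tensor product every
  tensor is a combination of the elements \<open>e i \<otimes> 1\<close> for a basis \<open>e\<close> of \<open>E / K\<close>; if its image vanishes,
  so do the coefficients, since \<open>e\<close> remains a basis over \<open>B\<close>.
\<close>

lemma tensor_rel_eq:
  fixes \<iota> :: "complex \<Rightarrow> 'b::comm_ring_1"
  assumes \<iota>: "unital_ring_hom \<iota>" and E: "psc.subspace E" and K: "psc.subspace K" and KE: "K \<subseteq> E"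
    and free: "free_quot pscale E K r"
  shows "tensor_rel \<iota> pscale E K = {t \<in> free_on E. tensor_eval \<iota> t \<in> extend_scalars \<iota> K}"
proof
  interpret te: module_hom fscale pscale "tensor_eval \<iota>" by (rule module_hom_tensor_eval)
  interpret \<iota>: semilinear "\<lambda>c. c" \<iota> \<iota> by (rule semilinear_hom[OF \<iota>])
  let ?R = "tensor_rel \<iota> pscale E K" and ?K = "{t \<in> free_on E. tensor_eval \<iota> t \<in> extend_scalars \<iota> K}"
  let ?d = "\<lambda>v. Poly_Mapping.single v (1::'b)"
  have R: "fsc.subspace ?R" unfolding tensor_rel_def by (rule fsc.subspace_span)
  have R_add: "?d (v + w) - ?d v - ?d w \<in> ?R" if "v \<in> E" "w \<in> E" for v w
    unfolding tensor_rel_def by (rule fsc.span_base) (use that in blast)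
  have R_scale: "?d (pscale c v) - Poly_Mapping.single v (\<iota> c) \<in> ?R" if "v \<in> E" for c v
    unfolding tensor_rel_def by (rule fsc.span_base) (use that in blast)
  have R_zero: "?d v \<in> ?R" if "v \<in> K" for v
    unfolding tensor_rel_def by (rule fsc.span_base) (use that in blast)
  have sub: "fsc.subspace ?K"
    by (rule fsc.subspaceI)
      (auto simp: fsc.subspace_0[OF subspace_free_on] fsc.subspace_add[OF subspace_free_on]
        fsc.subspace_scale[OF subspace_free_on] te.add te.scale psc.subspace_0 psc.subspace_add psc.subspace_scale)
  show "?R \<subseteq> ?K"
    unfolding tensor_rel_def
  proof (rule fsc.span_minimal[OF _ sub], safe)
    fix v w assume vw: "v \<in> E" "w \<in> E"
    then show "?d (v + w) - ?d v - ?d w \<in> free_on E"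
      by (intro fsc.subspace_diff[OF subspace_free_on] single_in_free_on psc.subspace_add[OF E])
    show "tensor_eval \<iota> (?d (v + w) - ?d v - ?d w) \<in> extend_scalars \<iota> K"
      by (simp add: te.diff tensor_eval_single \<iota>.base_change_add psc.subspace_0)
  next
    fix c v assume v: "v \<in> E"
    then show "?d (pscale c v) - Poly_Mapping.single v (\<iota> c) \<in> free_on E"
      by (intro fsc.subspace_diff[OF subspace_free_on] single_in_free_on psc.subspace_scale[OF E])
    show "tensor_eval \<iota> (?d (pscale c v) - Poly_Mapping.single v (\<iota> c)) \<in> extend_scalars \<iota> K"
      using \<iota>.base_change_pscale_hom[of c v]
      by (simp add: te.diff tensor_eval_single psc.subspace_0)
  next
    fix v assume v: "v \<in> K"
    then show "?d v \<in> free_on E" using KE by (intro single_in_free_on) auto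
    show "tensor_eval \<iota> (?d v) \<in> extend_scalars \<iota> K" using v by (simp add: tensor_eval_single base_change_in_extend_scalars)
  qed
  obtain e where e: "basis_away pscale 1 E K r e" using free by (auto simp: free_quot_def)
  have eE: "e i \<in> E" if "i < r" for i using e that by (simp add: basis_away_def)
  have comb: "?d (\<Sum>i\<in>A. pscale (c i) (e i)) - (\<Sum>i\<in>A. fscale (\<iota> (c i)) (?d (e i))) \<in> ?R"
    if "finite A" "A \<subseteq> {..<r}" for A c
    using that
  proof (induction A)
    case empty
    then show ?case using R_zero[OF psc.subspace_0[OF K]] by simp
  next
    case (insert a A)
    let ?x = "pscale (c a) (e a)" and ?y = "\<Sum>i\<in>A. pscale (c i) (e i)"
    have y: "?y \<in> E"
      using insert.prems eE by (intro psc.subspace_sum[OF E] psc.subspace_scale[OF E]) auto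
    have x: "?x \<in> E" "e a \<in> E" using insert.prems eE psc.subspace_scale[OF E] by auto
    have "(?d (?x + ?y) - ?d ?x - ?d ?y) + (?d ?x - Poly_Mapping.single (e a) (\<iota> (c a)))
        + (?d ?y - (\<Sum>i\<in>A. fscale (\<iota> (c i)) (?d (e i)))) \<in> ?R"
      using insert.IH insert.prems
      by (intro fsc.subspace_add[OF R fsc.subspace_add[OF R R_add[OF x(1) y] R_scale[OF x(2)]]]) auto
    then show ?case using insert.hyps by (simp add: fscale_single algebra_simps)
  qed
  let ?S = "\<lambda>b. \<Sum>i<r. fscale (b i) (?d (e i))"
  let ?U = "{t. \<exists>b. t - ?S b \<in> ?R}"
  have "free_on E \<subseteq> ?U"
  proof (rule free_on_minimal)
    show "fsc.subspace ?U"
    proof (rule fsc.subspaceI)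
      have "0 - ?S (\<lambda>_. 0) \<in> ?R" using fsc.subspace_0[OF R] by simp
      then show "0 \<in> ?U" by (intro CollectI exI[of _ "\<lambda>_. 0"])
    next
      fix t u assume "t \<in> ?U" "u \<in> ?U"
      then obtain b c where "t - ?S b \<in> ?R" "u - ?S c \<in> ?R" by blast
      from fsc.subspace_add[OF R this]
      have "(t + u) - ?S (\<lambda>i. b i + c i) \<in> ?R"
        by (simp add: fsc.scale_left_distrib sum.distrib algebra_simps)
      then show "t + u \<in> ?U" by (intro CollectI exI[of _ "\<lambda>i. b i + c i"])
    next
      fix a t assume "t \<in> ?U"
      then obtain b where "t - ?S b \<in> ?R" by blast
      from fsc.subspace_scale[OF R this, of a]
      have "fscale a t - ?S (\<lambda>i. a * b i) \<in> ?R"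
        by (simp add: fsc.scale_right_diff_distrib fsc.scale_sum_right)
      then show "fscale a t \<in> ?U" by (intro CollectI exI[of _ "\<lambda>i. a * b i"])
    qed
    fix v assume v: "v \<in> E"
    then obtain c where c: "v - (\<Sum>i<r. pscale (c i) (e i)) \<in> K"
      using e unfolding basis_away_def by fastforce
    let ?y = "\<Sum>i<r. pscale (c i) (e i)"
    have y: "?y \<in> E" using eE by (intro psc.subspace_sum[OF E] psc.subspace_scale[OF E]) auto
    have "(?d ((v - ?y) + ?y) - ?d (v - ?y) - ?d ?y) + ?d (v - ?y) + (?d ?y - ?S (\<lambda>i. \<iota> (c i))) \<in> ?R"
      by (intro fsc.subspace_add[OF R] R_add R_zero comb y c) (use c KE in auto)
    then have "?d v - ?S (\<lambda>i. \<iota> (c i)) \<in> ?R" by simp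
    then show "?d v \<in> ?U" by (intro CollectI exI[of _ "\<lambda>i. \<iota> (c i)"])
  qed
  show "?K \<subseteq> ?R"
  proof
    fix t assume t: "t \<in> ?K"
    then obtain b where b: "t - ?S b \<in> ?R" using \<open>free_on E \<subseteq> ?U\<close> by blast
    then have "tensor_eval \<iota> (t - ?S b) \<in> extend_scalars \<iota> K" using \<open>?R \<subseteq> ?K\<close> by blast
    then have "tensor_eval \<iota> t - tensor_eval \<iota> (t - ?S b) \<in> extend_scalars \<iota> K"
      using t by (intro psc.subspace_diff) auto
    then have "(\<Sum>i<r. pscale (b i) (base_change \<iota> (e i))) \<in> extend_scalars \<iota> K"
      by (simp add: te.diff te.sum te.scale tensor_eval_single)
    moreover have "basis_on pscale 1 (extend_scalars \<iota> E) (extend_scalars \<iota> K) {..<r} (\<lambda>i. base_change \<iota> (e i))"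
      using basis_extend_scalars[OF \<iota> K e] by (simp add: psc.basis_on_lessThan)
    ultimately have "b i = 0" if "i < r" for i
      using psc.basis_onD(3)[of 1 "extend_scalars \<iota> E" "extend_scalars \<iota> K" "{..<r}" "\<lambda>i. base_change \<iota> (e i)" b i] that by simp
    then have "?S b = 0" by simp
    with b show "t \<in> ?R" by simp
  qed
qed

section \<open>Base change of locally free quotients\<close>

lemma extend_scalars_twice:
  assumes \<iota>: "unital_ring_hom \<iota>" and \<phi>: "unital_ring_hom \<phi>"
  shows "extend_scalars \<phi> (extend_scalars \<iota> W) = extend_scalars (\<phi> \<circ> \<iota>) W"
proof
  interpret \<phi>: semilinear "\<lambda>c. c" \<phi> \<phi> by (rule semilinear_hom[OF \<phi>])
  interpret \<iota>: semilinear "\<lambda>c. c" \<iota> \<iota> by (rule semilinear_hom[OF \<iota>])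
  have comp: "base_change (\<phi> \<circ> \<iota>) h = base_change \<phi> (base_change \<iota> h)" for h
    by (intro poly2_eqI) (simp add: coeff2_base_change)
  show "extend_scalars (\<phi> \<circ> \<iota>) W \<subseteq> extend_scalars \<phi> (extend_scalars \<iota> W)"
    by (intro extend_scalars_minimal subspace_extend_scalars) (simp add: comp base_change_in_extend_scalars)
  have "extend_scalars \<iota> W \<subseteq> {g. base_change \<phi> g \<in> extend_scalars (\<phi> \<circ> \<iota>) W}"
  proof (rule extend_scalars_minimal)
    show "psc.subspace {g. base_change \<phi> g \<in> extend_scalars (\<phi> \<circ> \<iota>) W}"
      by (rule psc.subspaceI)
        (simp_all add: \<phi>.base_change_add \<phi>.base_change_pscale_hom psc.subspace_0 psc.subspace_add
          psc.subspace_scale)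
    fix h assume "h \<in> W"
    then show "base_change \<iota> h \<in> {g. base_change \<phi> g \<in> extend_scalars (\<phi> \<circ> \<iota>) W}"
      by (simp add: base_change_in_extend_scalars flip: comp)
  qed
  then show "extend_scalars \<phi> (extend_scalars \<iota> W) \<subseteq> extend_scalars (\<phi> \<circ> \<iota>) W"
    by (intro extend_scalars_minimal subspace_extend_scalars) blast
qed

lemma coordinates_exist:
  assumes I: "psc.subspace I" and v: "basis_away pscale (1::'b::comm_ring_1) UNIV I k v"
  shows "\<exists>c. (\<forall>g. g - (\<Sum>i<k. pscale (c g i) (v i)) \<in> I) \<and>
    (\<forall>g b i. g - (\<Sum>i<k. pscale (b i) (v i)) \<in> I \<longrightarrow> i < k \<longrightarrow> c g i = b i)"
proof -
  have "\<exists>b. g - (\<Sum>i<k. pscale (b i) (v i)) \<in> I" for g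
    using v by (simp add: basis_away_def)
  then obtain c where c: "\<And>g. g - (\<Sum>i<k. pscale (c g i) (v i)) \<in> I" by metis
  have "c g i = b i" if b: "g - (\<Sum>i<k. pscale (b i) (v i)) \<in> I" and i: "i < k" for g b i
  proof -
    have "(\<Sum>i<k. pscale (c g i - b i) (v i)) \<in> I"
      using psc.subspace_diff[OF I b c[of g]] by (simp add: psc.scale_left_diff_distrib sum_subtractf)
    from psc.basis_onD(3)[OF v[unfolded psc.basis_on_lessThan] this, of i] i show ?thesis by simp
  qed
  with c show ?thesis by blast
qed

text \<open>
  The bookkeeping identity for passing from generators \<open>v\<close> to generators \<open>w\<close> when \<open>m\<close> expresses
  \<open>a v\<^sub>i\<close> through the \<open>w\<^sub>j\<close>: the left side is a combination of elements that vanish in the quotient.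
\<close>

lemma change_of_generators:
  "pscale a (g - (\<Sum>i<k. pscale (c i) (v i)))
      + (\<Sum>i<k. pscale (c i) (pscale a (v i) - (\<Sum>j<n. pscale (m i j) (w j))))
    = pscale a g - (\<Sum>j<n. pscale (\<Sum>i<k. c i * m i j) (w j))"
proof -
  have "(\<Sum>i<k. pscale (c i) (\<Sum>j<n. pscale (m i j) (w j))) = (\<Sum>j<n. pscale (\<Sum>i<k. c i * m i j) (w j))"
    unfolding psc.scale_sum_right psc.scale_sum_left psc.scale_scale by (rule sum.swap)
  moreover have "pscale a (\<Sum>i<k. pscale (c i) (v i)) = (\<Sum>i<k. pscale (c i) (pscale a (v i)))"
    by (simp add: psc.scale_sum_right mult.commute)
  ultimately show ?thesis
    by (simp only: psc.scale_right_diff_distrib sum_subtractf) simp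
qed

text \<open>
  Linear independence is what has to be proved, since \<open>\<phi>\<close> need not be flat. After inverting \<open>f\<close> the
  coordinates with respect to \<open>e\<close> are linear functionals on \<open>B[x,y] / J\<close>, and a functional can be base
  changed. Because \<open>B[x,y] / I\<close> is finitely generated by \<open>v\<close>, a single power \<open>f ^ K\<close> clears the
  denominators, so that \<open>f ^ K\<close> times the coordinates are honest functionals \<open>\<gamma>\<close> with values in \<open>B\<close>,
  given by the matrix \<open>m\<close>. Their base change \<open>\<delta>\<close> vanishes locally on the base change of \<open>J\<close> and takes
  the values \<open>\<phi> f ^ K\<close> and \<open>0\<close> on the elements \<open>e i\<close>.
\<close>

lemma basis_away_base_change:
  fixes \<phi> :: "'b::comm_ring_1 \<Rightarrow> 'c::comm_ring_1"
  assumes \<phi>: "unital_ring_hom \<phi>" and I: "psc.subspace I" and J: "psc.subspace J" and IJ: "I \<subseteq> J"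
    and v: "basis_away pscale 1 UNIV I k v"
    and v': "basis_away pscale 1 UNIV (extend_scalars \<phi> I) k (\<lambda>i. base_change \<phi> (v i))"
    and e: "basis_away pscale f UNIV J n e"
  shows "basis_away pscale (\<phi> f) UNIV (extend_scalars \<phi> J) n (\<lambda>i. base_change \<phi> (e i))"
proof -
  interpret \<phi>: semilinear "\<lambda>c. c" \<phi> \<phi> by (rule semilinear_hom[OF \<phi>])
  have \<phi>_mult: "\<phi> (a * b) = \<phi> a * \<phi> b" for a b using \<phi> by (simp add: unital_ring_hom_def)
  have \<phi>_power: "\<phi> (a ^ m) = \<phi> a ^ m" for a m
    using \<phi> by (induction m) (simp_all add: unital_ring_hom_def)
  let ?v = "\<lambda>i. base_change \<phi> (v i)" and ?e = "\<lambda>j. base_change \<phi> (e j)"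
  note E = psc.basis_onD[OF e[unfolded psc.basis_on_lessThan]]
  from coordinates_exist[OF I v] obtain c where "\<forall>g. g - (\<Sum>i<k. pscale (c g i) (v i)) \<in> I"
    by (elim exE conjE)
  note c = this[rule_format]
  from coordinates_exist[OF subspace_extend_scalars v']
  obtain d where "\<forall>g. g - (\<Sum>i<k. pscale (d g i) (?v i)) \<in> extend_scalars \<phi> I"
    "\<forall>g b i. g - (\<Sum>i<k. pscale (b i) (?v i)) \<in> extend_scalars \<phi> I \<longrightarrow> i < k \<longrightarrow> d g i = b i"
    by (elim exE conjE)
  note d = this(1)[rule_format] and d_eq = this(2)[rule_format]
  have d_base_change: "d (base_change \<phi> g) i = \<phi> (c g i)" if "i < k" for g i
  proof (rule d_eq[OF _ that])
    have "base_change \<phi> (g - (\<Sum>i<k. pscale (c g i) (v i))) \<in> extend_scalars \<phi> I"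
      using c by (rule base_change_in_extend_scalars)
    then show "base_change \<phi> g - (\<Sum>i<k. pscale (\<phi> (c g i)) (?v i)) \<in> extend_scalars \<phi> I"
      by (simp add: \<phi>.base_change_diff base_change_linear[OF \<phi>])
  qed
  have d_add: "d (g + h) i = d g i + d h i" if "i < k" for g h i
  proof (rule d_eq[OF _ that])
    show "g + h - (\<Sum>i<k. pscale (d g i + d h i) (?v i)) \<in> extend_scalars \<phi> I"
      using psc.subspace_add[OF subspace_extend_scalars d[of g] d[of h]]
      by (simp add: psc.scale_left_distrib sum.distrib algebra_simps)
  qed
  have d_scale: "d (pscale a g) i = a * d g i" if "i < k" for a g i
  proof (rule d_eq[OF _ that])
    show "pscale a g - (\<Sum>i<k. pscale (a * d g i) (?v i)) \<in> extend_scalars \<phi> I"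
      using psc.subspace_scale[OF subspace_extend_scalars d[of g], of a]
      by (simp add: psc.scale_right_diff_distrib psc.scale_sum_right)
  qed
  have "\<exists>K. \<forall>i\<in>{..<k}. \<exists>b. pscale (f ^ K) (v i) - (\<Sum>j<n. pscale (b j) (e j)) \<in> J"
  proof (rule uniform_exponent)
    fix i K L assume "\<exists>b. pscale (f ^ K) (v i) - (\<Sum>j<n. pscale (b j) (e j)) \<in> J" "(K::nat) \<le> L"
    then obtain b where b: "pscale (f ^ K) (v i) - (\<Sum>j<n. pscale (b j) (e j)) \<in> J" by blast
    have "pscale (f ^ L) (v i) - (\<Sum>j<n. pscale (f ^ (L - K) * b j) (e j)) \<in> J"
      using psc.subspace_scale[OF J b, of "f ^ (L - K)"] \<open>K \<le> L\<close>
      by (simp add: psc.scale_right_diff_distrib psc.scale_sum_right flip: power_add)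
    then show "\<exists>b. pscale (f ^ L) (v i) - (\<Sum>j<n. pscale (b j) (e j)) \<in> J"
      by (intro exI[of _ "\<lambda>j. f ^ (L - K) * b j"])
  qed (use E(2) in auto)
  then obtain K m where m: "\<And>i. i < k \<Longrightarrow> pscale (f ^ K) (v i) - (\<Sum>j<n. pscale (m i j) (e j)) \<in> J"
    by (metis lessThan_iff)
  define \<gamma> where "\<gamma> g j = (\<Sum>i<k. c g i * m i j)" for g j
  have \<gamma>: "pscale (f ^ K) g - (\<Sum>j<n. pscale (\<gamma> g j) (e j)) \<in> J" for g
  proof -
    have "pscale (f ^ K) (g - (\<Sum>i<k. pscale (c g i) (v i)))
      + (\<Sum>i<k. pscale (c g i) (pscale (f ^ K) (v i) - (\<Sum>j<n. pscale (m i j) (e j)))) \<in> J"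
      using c[of g] IJ m
      by (intro psc.subspace_add[OF J] psc.subspace_scale[OF J] psc.subspace_sum[OF J]) auto
    then show ?thesis by (simp only: change_of_generators \<gamma>_def)
  qed
  define \<delta> where "\<delta> g j = (\<Sum>i<k. d g i * \<phi> (m i j))" for g j
  have \<delta>: "pscale (\<phi> f ^ K) g - (\<Sum>j<n. pscale (\<delta> g j) (?e j)) \<in> extend_scalars \<phi> J" for g
  proof -
    have m': "pscale (\<phi> f ^ K) (?v i) - (\<Sum>j<n. pscale (\<phi> (m i j)) (?e j)) \<in> extend_scalars \<phi> J" if "i < k" for i
      using base_change_in_extend_scalars[OF m[OF that], of \<phi>]
      by (simp add: \<phi>.base_change_diff base_change_linear[OF \<phi>] \<phi>.base_change_pscale_hom \<phi>_power)
    have "pscale (\<phi> f ^ K) (g - (\<Sum>i<k. pscale (d g i) (?v i)))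
      + (\<Sum>i<k. pscale (d g i) (pscale (\<phi> f ^ K) (?v i) - (\<Sum>j<n. pscale (\<phi> (m i j)) (?e j)))) \<in> extend_scalars \<phi> J"
      using d[of g] extend_scalars_mono[OF IJ, of \<phi>] m'
      by (intro psc.subspace_add psc.subspace_scale psc.subspace_sum subspace_extend_scalars) auto
    then show ?thesis by (simp only: change_of_generators \<delta>_def)
  qed
  have \<delta>_add: "\<delta> (g + h) j = \<delta> g j + \<delta> h j" for g h j
    by (simp add: \<delta>_def d_add distrib_right sum.distrib)
  have \<delta>_scale: "\<delta> (pscale a g) j = a * \<delta> g j" for a g j
    by (simp add: \<delta>_def d_scale sum_distrib_left mult.assoc)
  have \<delta>_zero: "\<delta> 0 j = 0" for j using \<delta>_scale[of 0 0 j] by simp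
  have \<delta>_sum: "\<delta> (sum h A) j = (\<Sum>i\<in>A. \<delta> (h i) j)" for h j and A :: "nat set"
    by (induction A rule: infinite_finite_induct) (simp_all add: \<delta>_zero \<delta>_add)
  have \<delta>_base_change: "\<delta> (base_change \<phi> g) j = \<phi> (\<gamma> g j)" for g j
    by (simp add: \<delta>_def \<gamma>_def d_base_change \<phi>.l_sum \<phi>_mult)
  let ?U = "{g. \<forall>j<n. \<exists>l. \<phi> f ^ l * \<delta> g j = 0}"
  have "extend_scalars \<phi> J \<subseteq> ?U"
  proof (rule extend_scalars_minimal)
    show "psc.subspace ?U"
    proof (rule psc.subspaceI)
      show "0 \<in> ?U" by (simp add: \<delta>_zero)
    next
      fix g h assume gh: "g \<in> ?U" "h \<in> ?U"
      have "\<exists>l. \<phi> f ^ l * \<delta> (g + h) j = 0" if j: "j < n" for j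
      proof -
        obtain a b where "\<phi> f ^ a * \<delta> g j = 0" "\<phi> f ^ b * \<delta> h j = 0" using gh j by blast
        then have "\<phi> f ^ b * (\<phi> f ^ a * \<delta> g j) + \<phi> f ^ a * (\<phi> f ^ b * \<delta> h j) = 0" by simp
        then have "\<phi> f ^ (a + b) * \<delta> (g + h) j = 0" by (simp add: \<delta>_add power_add algebra_simps)
        then show ?thesis by blast
      qed
      then show "g + h \<in> ?U" by blast
    next
      fix a g assume g: "g \<in> ?U"
      have "\<exists>l. \<phi> f ^ l * \<delta> (pscale a g) j = 0" if j: "j < n" for j
      proof -
        obtain l where "\<phi> f ^ l * \<delta> g j = 0" using g j by blast
        then have "\<phi> f ^ l * \<delta> (pscale a g) j = 0" by (simp add: \<delta>_scale mult.left_commute)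
        then show ?thesis by blast
      qed
      then show "pscale a g \<in> ?U" by blast
    qed
    fix h assume h: "h \<in> J"
    have "pscale (f ^ K) h - (pscale (f ^ K) h - (\<Sum>j<n. pscale (\<gamma> h j) (e j))) \<in> J"
      by (rule psc.subspace_diff[OF J psc.subspace_scale[OF J h] \<gamma>])
    then have s: "(\<Sum>j<n. pscale (\<gamma> h j) (e j)) \<in> J" by simp
    have "\<exists>l. \<phi> f ^ l * \<delta> (base_change \<phi> h) j = 0" if j: "j < n" for j
    proof -
      obtain l where "f ^ l * \<gamma> h j = 0" using E(3)[OF s, of j] j by auto
      then have "\<phi> (f ^ l * \<gamma> h j) = 0" by (simp add: \<phi>.zero)
      then have "\<phi> f ^ l * \<delta> (base_change \<phi> h) j = 0" by (simp add: \<delta>_base_change \<phi>_mult \<phi>_power)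
      then show ?thesis by blast
    qed
    then show "base_change \<phi> h \<in> ?U" by blast
  qed
  show ?thesis
    unfolding basis_away_def
  proof (intro conjI ballI allI impI)
    fix g show "\<exists>l b. pscale (\<phi> f ^ l) g - (\<Sum>i<n. pscale (b i) (?e i)) \<in> extend_scalars \<phi> J"
      using \<delta>[of g] by blast
  next
    fix b j assume b: "(\<Sum>i<n. pscale (b i) (?e i)) \<in> extend_scalars \<phi> J" and j: "j < n"
    then obtain l where l: "\<phi> f ^ l * \<delta> (\<Sum>i<n. pscale (b i) (?e i)) j = 0"
      using \<open>extend_scalars \<phi> J \<subseteq> ?U\<close> by blast
    let ?kr = "\<lambda>i. if i = j then f ^ K else 0"
    have "\<exists>a. f ^ a * (\<gamma> (e i) j - ?kr i) = 0" if i: "i \<in> {..<n}" for i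
    proof -
      have "(\<Sum>q<n. pscale (\<gamma> (e i) q - (if i = q then f ^ K else 0)) (e q))
        = - (pscale (f ^ K) (e i) - (\<Sum>q<n. pscale (\<gamma> (e i) q) (e q)))"
      proof -
        have "(\<Sum>q<n. pscale (if i = q then f ^ K else 0) (e q)) = (\<Sum>q<n. if i = q then pscale (f ^ K) (e q) else 0)"
          by (intro sum.cong) auto
        also have "\<dots> = pscale (f ^ K) (e i)" using i by simp
        finally show ?thesis by (simp add: psc.scale_left_diff_distrib sum_subtractf)
      qed
      then have "(\<Sum>q<n. pscale (\<gamma> (e i) q - (if i = q then f ^ K else 0)) (e q)) \<in> J"
        using psc.subspace_neg[OF J \<gamma>[of "e i"]] by simp
      from E(3)[OF this, of j] j show ?thesis by simp
    qed
    then obtain a where a: "\<forall>i\<in>{..<n}. f ^ a * (\<gamma> (e i) j - ?kr i) = 0"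
      using uniform_annihilator[of "{..<n}" f "\<lambda>i. \<gamma> (e i) j - ?kr i"] by auto
    have entry: "\<phi> f ^ a * \<phi> (\<gamma> (e i) j) = (if i = j then \<phi> f ^ (a + K) else 0)" if "i < n" for i
    proof -
      have "f ^ a * \<gamma> (e i) j = f ^ a * ?kr i" using a that by (simp add: right_diff_distrib)
      then have "\<phi> (f ^ a * \<gamma> (e i) j) = \<phi> (f ^ a * ?kr i)" by simp
      then show ?thesis by (simp add: \<phi>_mult \<phi>_power \<phi>.zero power_add split: if_splits)
    qed
    have "\<phi> f ^ a * \<delta> (\<Sum>i<n. pscale (b i) (?e i)) j = (\<Sum>i<n. b i * (\<phi> f ^ a * \<phi> (\<gamma> (e i) j)))"
      by (simp add: \<delta>_sum \<delta>_scale \<delta>_base_change sum_distrib_left mult.left_commute)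
    also have "\<dots> = (\<Sum>i<n. if i = j then b i * \<phi> f ^ (a + K) else 0)"
      by (intro sum.cong) (auto simp: entry)
    also have "\<dots> = b j * \<phi> f ^ (a + K)" using j by simp
    finally have "\<phi> f ^ l * (b j * \<phi> f ^ (a + K)) = \<phi> f ^ l * (\<phi> f ^ a * \<delta> (\<Sum>i<n. pscale (b i) (?e i)) j)"
      by (simp only:)
    also have "\<dots> = \<phi> f ^ a * (\<phi> f ^ l * \<delta> (\<Sum>i<n. pscale (b i) (?e i)) j)"
      by (rule mult.left_commute)
    also have "\<dots> = 0" using l by simp
    finally have "\<phi> f ^ (l + (a + K)) * b j = 0" by (simp add: power_add mult_ac)
    then show "\<exists>l. \<phi> f ^ l * b j = 0" by blast
  qed simp
qed

lemma span_image_hom: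
  assumes \<phi>: "unital_ring_hom \<phi>" and "1 \<in> ring.span F"
  shows "1 \<in> ring.span (\<phi> ` F)"
proof -
  interpret \<phi>: semilinear "\<lambda>c. c" \<phi> \<phi> by (rule semilinear_hom[OF \<phi>])
  have "ring.subspace {x. \<phi> x \<in> ring.span (\<phi> ` F)}"
    using \<phi> by (intro ring.subspaceI)
      (simp_all add: \<phi>.zero \<phi>.l_add ring.span_zero ring.span_add unital_ring_hom_def ring.span_scale)
  then have "ring.span F \<subseteq> {x. \<phi> x \<in> ring.span (\<phi> ` F)}"
    by (intro ring.span_minimal) (auto intro: ring.span_base)
  with assms show ?thesis by (auto simp: unital_ring_hom_def)
qed

lemma locally_free_base_change:
  assumes \<phi>: "unital_ring_hom \<phi>" and "psc.subspace I" "psc.subspace J" "I \<subseteq> J"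
    and "basis_away pscale 1 UNIV I k v"
    and "basis_away pscale 1 UNIV (extend_scalars \<phi> I) k (\<lambda>i. base_change \<phi> (v i))"
    and "locally_free_quot pscale UNIV J n"
  shows "locally_free_quot pscale UNIV (extend_scalars \<phi> J) n"
proof -
  obtain F where F: "finite F" "1 \<in> ring.span F" "\<And>f. f \<in> F \<Longrightarrow> \<exists>e. basis_away pscale f UNIV J n e"
    using assms(7) by (auto simp: locally_free_quot_def)
  have "\<exists>e. basis_away pscale (\<phi> f) UNIV (extend_scalars \<phi> J) n e" if "f \<in> F" for f
    using F(3)[OF that] basis_away_base_change[OF assms(1-6)] by blast
  with F(1) span_image_hom[OF \<phi> F(2)] show ?thesis
    unfolding locally_free_quot_def by (intro exI[of _ "\<phi> ` F"]) auto
qed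

section \<open>Points of the fibre and line subbundles\<close>

lemma univ_familyD:
  fixes I :: "complex poly poly set"
  assumes "(I, p) \<in> univ_family (Suc n)"
  shows "ring.subspace I" "free_quot pscale UNIV I (Suc n)"
  using assms by (simp_all add: univ_family_complex_iff)

text \<open>
  The fibre in terms of submodules alone. That the residual point is \<open>p\<close> means that \<open>J\<close> lies in the
  extended socle; conversely a submodule of the extended socle that contains \<open>I B[x,y]\<close> is an ideal,
  because the ring acts on it by scalars modulo \<open>I B[x,y]\<close>.
\<close>

lemma mem_fibre_rho_iff:
  fixes \<iota> :: "complex \<Rightarrow> 'b::comm_ring_1"
  assumes I: "(I, p) \<in> univ_family (Suc n)" and \<iota>: "unital_ring_hom \<iota>"
  shows "(I', J) \<in> fibre_rho \<iota> n I p \<longleftrightarrow>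
    I' = extend_scalars \<iota> I \<and> psc.subspace J \<and> extend_scalars \<iota> I \<subseteq> J \<and> J \<subseteq> extend_scalars \<iota> (soc_num I p) \<and>
    locally_free_quot pscale UNIV J n"
proof -
  note idI = univ_familyD(1)[OF I]
  note eq = pull_ideal_eq_extend_scalars[OF \<iota> idI]
  let ?q = "map_prod \<iota> \<iota> p"
  have idB: "ring.subspace (extend_scalars \<iota> I)"
    unfolding eq[symmetric] pull_ideal_def by simp
  have freeB: "locally_free_quot pscale UNIV (extend_scalars \<iota> I) (Suc n)"
    using free_extend_scalars[OF \<iota> psc_subspace_ideal[OF idI] univ_familyD(2)[OF I]]
    by (simp add: extend_scalars_UNIV[OF \<iota>] psc.free_imp_locally_free)
  have soc: "J \<subseteq> extend_scalars \<iota> (soc_num I p) \<longleftrightarrow> (\<forall>g. \<forall>j\<in>J. g * j - pscale (eval2 ?q g) j \<in> extend_scalars \<iota> I)"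
    unfolding subset_eq mem_extend_scalars_soc_iff[OF \<iota> idI] by blast
  show ?thesis
  proof
    assume "(I', J) \<in> fibre_rho \<iota> n I p"
    then have N: "(I', J) \<in> nested_hilb n" and I': "I' = extend_scalars \<iota> I" and r: "res I' J = ?q"
      by (auto simp: fibre_rho_def rho_def eq)
    from r[unfolded res_eq_iff[OF N]] nested_hilbD[OF N] I'
    show "I' = extend_scalars \<iota> I \<and> psc.subspace J \<and> extend_scalars \<iota> I \<subseteq> J \<and> J \<subseteq> extend_scalars \<iota> (soc_num I p) \<and>
      locally_free_quot pscale UNIV J n"
      by (simp add: soc psc_subspace_ideal)
  next
    assume *: "I' = extend_scalars \<iota> I \<and> psc.subspace J \<and> extend_scalars \<iota> I \<subseteq> J \<and> J \<subseteq> extend_scalars \<iota> (soc_num I p) \<and>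
      locally_free_quot pscale UNIV J n"
    then have act: "g * j - pscale (eval2 ?q g) j \<in> extend_scalars \<iota> I" if "j \<in> J" for g j
      using that unfolding soc by blast
    have J: "psc.subspace J" and IJ: "extend_scalars \<iota> I \<subseteq> J" using * by auto
    have mult: "g * j \<in> J" if j: "j \<in> J" for g j
      using psc.subspace_add[OF J subsetD[OF IJ act[OF j, of g]] psc.subspace_scale[OF J j, of "eval2 ?q g"]]
      by simp
    have "ring.subspace J" by (intro idealI_xy J mult)
    then have N: "(I', J) \<in> nested_hilb n"
      using * idB freeB by (simp add: nested_hilb_def hilb_def)
    have "res I' J = ?q" unfolding res_eq_iff[OF N] using * act by blast
    with N * show "(I', J) \<in> fibre_rho \<iota> n I p"
      by (simp add: fibre_rho_def rho_def eq)
  qed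
qed

lemma socle_ranks:
  assumes I: "(I, p) \<in> univ_family (Suc n)"
  obtains m d where "Suc n = m + d" "free_quot pscale UNIV (soc_num I p) m" "free_quot pscale (soc_num I p) I d"
proof -
  let ?E = "soc_num I p"
  note idI = univ_familyD(1)[OF I] and free = univ_familyD(2)[OF I]
  note pI = psc_subspace_ideal[OF idI] and pE = subspace_soc_num[OF idI, of p]
    and IE = subset_soc_num[OF idI, of p]
  from quotient_of_free_over_field[OF module_pscale _ pE IE _ free]
  obtain m where m: "m \<le> Suc n" "free_quot pscale UNIV ?E m" by auto
  then have "locally_free_quot pscale ?E I (Suc n - m)"
    using psc.locally_free_kernel[of UNIV I ?E m "Suc n - m"] free pI pE IE
    by (simp add: psc.free_imp_locally_free)
  from locally_free_imp_free_over_field[OF module_pscale pI this] m show thesis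
    by (intro that[of m "Suc n - m"]) simp_all
qed

text \<open>
  Let \<open>m\<close> be the codimension and \<open>d\<close> the dimension of the socle, so that \<open>m + d = n + 1\<close>. The tensor
  evaluation identifies the line with \<open>J / I B[x,y]\<close> and its cokernel with \<open>E / J\<close>, where \<open>E\<close> is the
  extended socle. From \<open>B[x,y] / J\<close> of rank \<open>n\<close> these are kernels of ranks \<open>1\<close> and \<open>n - m = d - 1\<close>;
  conversely \<open>B[x,y] / J\<close> is an extension of \<open>B[x,y] / E\<close>, of rank \<open>m\<close>, by \<open>E / J\<close>.
\<close>

lemma soc_line_mem_proj_lines_iff:
  fixes \<iota> :: "complex \<Rightarrow> 'b::comm_ring_1"
  assumes I: "(I, p) \<in> univ_family (Suc n)" and \<iota>: "unital_ring_hom \<iota>"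
    and J: "psc.subspace J" and IJ: "extend_scalars \<iota> I \<subseteq> J" and JE: "J \<subseteq> extend_scalars \<iota> (soc_num I p)"
  shows "soc_line \<iota> I p (I', J) \<in> proj_lines \<iota> pscale (soc_num I p) I \<longleftrightarrow> locally_free_quot pscale UNIV J n"
proof -
  let ?E = "soc_num I p" and ?te = "tensor_eval \<iota>"
  let ?L = "soc_line \<iota> I p (I', J)"
  interpret te: module_hom fscale pscale ?te by (rule module_hom_tensor_eval)
  note idI = univ_familyD(1)[OF I]
  note pI = psc_subspace_ideal[OF idI] and pE = subspace_soc_num[OF idI, of p]
    and IE = subset_soc_num[OF idI, of p]
  obtain m d where md: "Suc n = m + d" and m: "free_quot pscale UNIV ?E m" and d: "free_quot pscale ?E I d"
    by (rule socle_ranks[OF I])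
  have L: "?L = {t \<in> free_on ?E. ?te t \<in> J}" by (simp add: soc_line_def)
  have rel: "tensor_rel \<iota> pscale ?E I = {t \<in> free_on ?E. ?te t \<in> extend_scalars \<iota> I}"
    by (rule tensor_rel_eq[OF \<iota> pE pI IE d])
  have subL: "fsc.subspace ?L"
  proof -
    have "?L = free_on ?E \<inter> (?te -` J)" by (auto simp: L)
    then show ?thesis using fsc.subspace_inter[OF subspace_free_on te.subspace_vimage[OF J]] by metis
  qed
  have relL: "tensor_rel \<iota> pscale ?E I \<subseteq> ?L" using IJ unfolding rel L by blast
  have onto: "\<exists>t\<in>free_on ?E. g - ?te t = 0" if "g \<in> extend_scalars \<iota> ?E" for g
    using that unfolding tensor_eval_free_on[symmetric] by auto
  have line: "locally_free_quot fscale ?L (tensor_rel \<iota> pscale ?E I) r \<longleftrightarrow> locally_free_quot pscale J (extend_scalars \<iota> I) r" for r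
  proof (rule locally_free_transport[OF module_hom_tensor_eval subL subspace_extend_scalars])
    show "?te ` ?L \<subseteq> J" by (auto simp: L)
    show "\<exists>t\<in>?L. g - ?te t \<in> extend_scalars \<iota> I" if "g \<in> J" for g
    proof -
      obtain t where t: "t \<in> free_on ?E" "g - ?te t = 0" using onto[of g] JE \<open>g \<in> J\<close> by blast
      with \<open>g \<in> J\<close> have "t \<in> ?L" by (simp add: L)
      with t show ?thesis using psc.subspace_0[OF subspace_extend_scalars] by metis
    qed
    show "tensor_rel \<iota> pscale ?E I = {t \<in> ?L. ?te t \<in> extend_scalars \<iota> I}"
      using IJ by (auto simp: L rel)
  qed
  have quot: "locally_free_quot fscale (free_on ?E) ?L r \<longleftrightarrow> locally_free_quot pscale (extend_scalars \<iota> ?E) J r" for r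
  proof (rule locally_free_transport[OF module_hom_tensor_eval subspace_free_on J])
    show "?te ` free_on ?E \<subseteq> extend_scalars \<iota> ?E" by (simp add: tensor_eval_free_on)
    show "\<exists>t\<in>free_on ?E. g - ?te t \<in> J" if "g \<in> extend_scalars \<iota> ?E" for g
      using onto[OF that] psc.subspace_0[OF J] by metis
  qed (rule L)
  have freeE: "locally_free_quot pscale UNIV (extend_scalars \<iota> ?E) m"
    using free_extend_scalars[OF \<iota> pE m] by (simp add: extend_scalars_UNIV[OF \<iota>] psc.free_imp_locally_free)
  have freeI: "locally_free_quot pscale UNIV (extend_scalars \<iota> I) (Suc n)"
    using free_extend_scalars[OF \<iota> pI univ_familyD(2)[OF I]] by (simp add: extend_scalars_UNIV[OF \<iota>] psc.free_imp_locally_free)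
  show ?thesis
  proof
    assume n: "locally_free_quot pscale UNIV J n"
    have one: "locally_free_quot pscale J (extend_scalars \<iota> I) 1"
      using psc.locally_free_kernel[of UNIV "extend_scalars \<iota> I" J n 1] freeI n J IJ by simp
    \<comment> \<open>With a zero socle the line \<open>J / I B[x,y]\<close> would be zero as well.\<close>
    have "d \<noteq> 0"
    proof
      assume "d = 0"
      with d have "?E \<subseteq> I" by (auto simp: free_quot_def basis_away_def)
      then have "J = extend_scalars \<iota> I" using IJ JE extend_scalars_mono by blast
      with one psc.locally_free_zero_quot[OF J, of 1] show False by simp
    qed
    then obtain r where r: "d = Suc r" by (cases d) auto
    have "locally_free_quot pscale (extend_scalars \<iota> ?E) J r"
      using psc.locally_free_kernel[of UNIV J "extend_scalars \<iota> ?E" m r] n freeE J JE md r by simp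
    with one d r show "?L \<in> proj_lines \<iota> pscale ?E I"
      unfolding proj_lines_def using subL relL line quot L by auto
  next
    assume "?L \<in> proj_lines \<iota> pscale ?E I"
    then obtain r where r: "free_quot pscale ?E I (Suc r)" "locally_free_quot fscale (free_on ?E) ?L r"
      unfolding proj_lines_def by blast
    have "d = Suc r"
      using psc.locally_free_rank_unique[OF pE pI IE] d r(1) by (simp add: psc.free_imp_locally_free)
    with md have n: "n = m + r" by simp
    have "locally_free_quot pscale (extend_scalars \<iota> ?E) J r" using r(2) by (simp add: quot)
    then show "locally_free_quot pscale UNIV J n"
      unfolding n using freeE J JE by (intro psc.locally_free_extension[of UNIV "extend_scalars \<iota> ?E" J]) simp_all
  qed
qed

lemma tensor_eval_soc_line:
  assumes "J \<subseteq> extend_scalars \<iota> (soc_num I p)"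
  shows "tensor_eval \<iota> ` soc_line \<iota> I p (I', J) = J"
  using assms unfolding tensor_eval_free_on[symmetric] soc_line_def by auto

text \<open>
  A submodule of \<open>Soc \<otimes> B\<close> is the preimage of its image, as the tensor evaluation has kernel
  \<open>tensor_rel\<close> modulo \<open>I B[x,y]\<close>.
\<close>

lemma proj_line_is_soc_line:
  fixes \<iota> :: "complex \<Rightarrow> 'b::comm_ring_1"
  assumes I: "(I, p) \<in> univ_family (Suc n)" and \<iota>: "unital_ring_hom \<iota>"
    and L: "fsc.subspace L" "tensor_rel \<iota> pscale (soc_num I p) I \<subseteq> L" "L \<subseteq> free_on (soc_num I p)"
  shows "L = soc_line \<iota> I p (I', tensor_eval \<iota> ` L)"
proof -
  interpret te: module_hom fscale pscale "tensor_eval \<iota>" by (rule module_hom_tensor_eval)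
  note idI = univ_familyD(1)[OF I]
  obtain m d where d: "free_quot pscale (soc_num I p) I d" by (rule socle_ranks[OF I])
  note rel = tensor_rel_eq[OF \<iota> subspace_soc_num[OF idI, of p] psc_subspace_ideal[OF idI]
      subset_soc_num[OF idI] d]
  have "t \<in> L" if t: "t \<in> free_on (soc_num I p)" "tensor_eval \<iota> t = tensor_eval \<iota> u" and u: "u \<in> L" for t u
  proof -
    have "t - u \<in> tensor_rel \<iota> pscale (soc_num I p) I"
      unfolding rel using t u L(3) fsc.subspace_diff[OF subspace_free_on, of t _ u]
      by (auto simp: te.diff psc.subspace_0)
    with L(2) have "t - u \<in> L" by blast
    from fsc.subspace_add[OF L(1) this u] show ?thesis by simp
  qed
  with L(3) show ?thesis unfolding soc_line_def by auto
qed

lemma bij_soc_line: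
  fixes \<iota> :: "complex \<Rightarrow> 'b::comm_ring_1"
  assumes I: "(I, p) \<in> univ_family (Suc n)" and \<iota>: "unital_ring_hom \<iota>"
  shows "bij_betw (soc_line \<iota> I p) (fibre_rho \<iota> n I p) (proj_lines \<iota> pscale (soc_num I p) I)"
proof (rule bij_betw_imageI)
  let ?E = "soc_num I p"
  note idI = univ_familyD(1)[OF I]
  note fibre = mem_fibre_rho_iff[OF I \<iota>]
  show "inj_on (soc_line \<iota> I p) (fibre_rho \<iota> n I p)"
  proof (rule inj_onI)
    fix z w assume "z \<in> fibre_rho \<iota> n I p" "w \<in> fibre_rho \<iota> n I p"
      and eq: "soc_line \<iota> I p z = soc_line \<iota> I p w"
    moreover obtain A J B K where zw: "z = (A, J)" "w = (B, K)" by fastforce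
    ultimately have "A = B" "J \<subseteq> extend_scalars \<iota> ?E" "K \<subseteq> extend_scalars \<iota> ?E" by (simp_all add: fibre)
    moreover from this eq zw have "J = K" by (metis tensor_eval_soc_line)
    ultimately show "z = w" by (simp add: zw)
  qed
  show "soc_line \<iota> I p ` fibre_rho \<iota> n I p = proj_lines \<iota> pscale ?E I"
  proof
    show "soc_line \<iota> I p ` fibre_rho \<iota> n I p \<subseteq> proj_lines \<iota> pscale ?E I"
      using fibre soc_line_mem_proj_lines_iff[OF I \<iota>] by fastforce
    show "proj_lines \<iota> pscale ?E I \<subseteq> soc_line \<iota> I p ` fibre_rho \<iota> n I p"
    proof
      fix L assume pL: "L \<in> proj_lines \<iota> pscale ?E I"
      then have L: "fsc.subspace L" "tensor_rel \<iota> pscale ?E I \<subseteq> L" "L \<subseteq> free_on ?E"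
        unfolding proj_lines_def by blast+
      define J where "J = tensor_eval \<iota> ` L"
      have LJ: "L = soc_line \<iota> I p (extend_scalars \<iota> I, J)"
        unfolding J_def by (rule proj_line_is_soc_line[OF I \<iota> L])
      interpret te: module_hom fscale pscale "tensor_eval \<iota>" by (rule module_hom_tensor_eval)
      have J: "psc.subspace J" unfolding J_def by (rule te.subspace_image[OF L(1)])
      have JE: "J \<subseteq> extend_scalars \<iota> ?E" unfolding J_def tensor_eval_free_on[symmetric] using L(3) by blast
      have IJ: "extend_scalars \<iota> I \<subseteq> J"
      proof (rule extend_scalars_minimal[OF J])
        fix h assume "h \<in> I"
        then have "Poly_Mapping.single h 1 \<in> tensor_rel \<iota> pscale ?E I"
          unfolding tensor_rel_def by (intro fsc.span_base) blast
        with L(2) have "Poly_Mapping.single h 1 \<in> L" by blast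
        then have "tensor_eval \<iota> (Poly_Mapping.single h 1) \<in> J" unfolding J_def by (rule imageI)
        then show "base_change \<iota> h \<in> J" by (simp add: tensor_eval_single)
      qed
      have "(extend_scalars \<iota> I, J) \<in> fibre_rho \<iota> n I p"
        using soc_line_mem_proj_lines_iff[OF I \<iota> J IJ JE, of "extend_scalars \<iota> I"] pL J IJ JE
        unfolding fibre LJ[symmetric] by blast
      with LJ show "L \<in> soc_line \<iota> I p ` fibre_rho \<iota> n I p" by blast
    qed
  qed
qed

section \<open>Naturality\<close>

text \<open>
  The defining relations of the tensor product over \<open>C\<close> are the images of those over \<open>B\<close>.
\<close>

lemma tensor_rel_subset_pull_sub:
  fixes \<iota> :: "complex \<Rightarrow> 'b::comm_ring_1" and \<phi> :: "'b \<Rightarrow> 'c::comm_ring_1"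
  assumes \<phi>: "unital_ring_hom \<phi>" and L: "tensor_rel \<iota> sc E K \<subseteq> L"
  shows "tensor_rel (\<phi> \<circ> \<iota>) sc E K \<subseteq> pull_sub \<phi> L"
proof -
  interpret \<phi>: semilinear "\<lambda>c. c" \<phi> \<phi> by (rule semilinear_hom[OF \<phi>])
  have \<phi>1: "\<phi> 1 = 1" using \<phi> by (simp add: unital_ring_hom_def)
  have diff: "Poly_Mapping.map \<phi> (s - t) = Poly_Mapping.map \<phi> s - Poly_Mapping.map \<phi> t" for s t
    using \<phi>.l_add[of "a - b" b for a b]
    by (intro poly_mapping_eqI) (simp add: lookup_map_hom lookup_minus eq_diff_eq)
  have single: "Poly_Mapping.map \<phi> (Poly_Mapping.single v b) = Poly_Mapping.single v (\<phi> b)" for v b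
    by (intro poly_mapping_eqI) (simp add: lookup_map_hom lookup_single when_def)
  have gen: "Poly_Mapping.map \<phi> t \<in> pull_sub \<phi> L" if "t \<in> tensor_rel \<iota> sc E K" for t
    unfolding pull_sub_def using that L by (intro fsc.span_base) blast
  show ?thesis
    unfolding tensor_rel_def[of "\<phi> \<circ> \<iota>"]
  proof (rule fsc.span_minimal, safe)
    fix v w assume "v \<in> E" "w \<in> E"
    then have "Poly_Mapping.single (v + w) 1 - Poly_Mapping.single v 1 - Poly_Mapping.single w 1 \<in> tensor_rel \<iota> sc E K"
      unfolding tensor_rel_def by (intro fsc.span_base) blast
    from gen[OF this]
    show "Poly_Mapping.single (v + w) 1 - Poly_Mapping.single v 1 - Poly_Mapping.single w 1 \<in> pull_sub \<phi> L"
      by (simp add: diff single \<phi>1)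
  next
    fix c v assume "v \<in> E"
    then have "Poly_Mapping.single (sc c v) 1 - Poly_Mapping.single v (\<iota> c) \<in> tensor_rel \<iota> sc E K"
      unfolding tensor_rel_def by (intro fsc.span_base) blast
    from gen[OF this]
    show "Poly_Mapping.single (sc c v) 1 - Poly_Mapping.single v ((\<phi> \<circ> \<iota>) c) \<in> pull_sub \<phi> L"
      by (simp add: diff single \<phi>1)
  next
    fix v assume "v \<in> K"
    then have "Poly_Mapping.single v 1 \<in> tensor_rel \<iota> sc E K"
      unfolding tensor_rel_def by (intro fsc.span_base) blast
    from gen[OF this] show "Poly_Mapping.single v 1 \<in> pull_sub \<phi> L" by (simp add: single \<phi>1)
  qed (simp add: pull_sub_def)
qed

lemma tensor_eval_pull_sub:
  assumes \<iota>: "unital_ring_hom \<iota>" and \<phi>: "unital_ring_hom \<phi>"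
  shows "tensor_eval (\<phi> \<circ> \<iota>) ` pull_sub \<phi> L = extend_scalars \<phi> (tensor_eval \<iota> ` L)"
proof -
  interpret \<phi>: semilinear "\<lambda>c. c" \<phi> \<phi> by (rule semilinear_hom[OF \<phi>])
  interpret \<iota>: semilinear "\<lambda>c. c" \<iota> \<iota> by (rule semilinear_hom[OF \<iota>])
  interpret te: module_hom fscale pscale "tensor_eval (\<phi> \<circ> \<iota>)" by (rule module_hom_tensor_eval)
  have "tensor_eval (\<phi> \<circ> \<iota>) (Poly_Mapping.map \<phi> t) = base_change \<phi> (tensor_eval \<iota> t)" for t
  proof -
    have "Poly_Mapping.keys (Poly_Mapping.map \<phi> t) \<subseteq> Poly_Mapping.keys t"
      by (auto simp: in_keys_iff lookup_map_hom)
    moreover have "base_change (\<phi> \<circ> \<iota>) h = base_change \<phi> (base_change \<iota> h)" for h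
      by (intro poly2_eqI) (simp add: coeff2_base_change)
    ultimately show ?thesis
      by (simp add: tensor_eval_superset[of "Poly_Mapping.keys t"] lookup_map_hom
          tensor_eval_def[of \<iota>] base_change_linear[OF \<phi>])
  qed
  then have "tensor_eval (\<phi> \<circ> \<iota>) ` Poly_Mapping.map \<phi> ` L = base_change \<phi> ` tensor_eval \<iota> ` L"
    by (simp add: image_image)
  then show ?thesis
    unfolding pull_sub_def extend_scalars_def te.span_image[symmetric] by simp
qed

lemma pull_sub_subset_free_on:
  assumes \<phi>: "unital_ring_hom \<phi>" and L: "L \<subseteq> free_on E"
  shows "pull_sub \<phi> L \<subseteq> free_on E"
proof -
  interpret \<phi>: semilinear "\<lambda>c. c" \<phi> \<phi> by (rule semilinear_hom[OF \<phi>])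
  have "Poly_Mapping.map \<phi> t \<in> free_on E" if "t \<in> free_on E" for t
    using that by (fastforce simp: free_on_def in_keys_iff lookup_map_hom)
  then show ?thesis
    unfolding pull_sub_def by (intro fsc.span_minimal subspace_free_on) (use L in blast)
qed

text \<open>
  Naturality. On the side of ideals it needs that local freeness survives base change; the two lines
  then agree because they have the same image in \<open>C[x,y]\<close> and are both preimages of it.
\<close>

lemma fibre_rho_base_change:
  fixes \<iota> :: "complex \<Rightarrow> 'b::comm_ring_1" and \<phi> :: "'b \<Rightarrow> 'c::comm_ring_1"
  assumes I: "(I, p) \<in> univ_family (Suc n)" and \<iota>: "unital_ring_hom \<iota>" and \<phi>: "unital_ring_hom \<phi>"
    and \<phi>\<iota>: "unital_ring_hom (\<phi> \<circ> \<iota>)" and IJ: "(I', J) \<in> fibre_rho \<iota> n I p"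
  shows "(pull_ideal \<phi> I', pull_ideal \<phi> J) \<in> fibre_rho (\<phi> \<circ> \<iota>) n I p"
    "soc_line (\<phi> \<circ> \<iota>) I p (pull_ideal \<phi> I', pull_ideal \<phi> J) = pull_sub \<phi> (soc_line \<iota> I p (I', J))"
proof -
  let ?E = "soc_num I p"
  note idI = univ_familyD(1)[OF I]
  have N: "(I', J) \<in> nested_hilb n" using IJ by (simp add: fibre_rho_def)
  have F: "I' = extend_scalars \<iota> I" "psc.subspace J" "extend_scalars \<iota> I \<subseteq> J" "J \<subseteq> extend_scalars \<iota> ?E" "locally_free_quot pscale UNIV J n"
    using IJ unfolding mem_fibre_rho_iff[OF I \<iota>] by blast+
  have pull: "pull_ideal \<phi> I' = extend_scalars (\<phi> \<circ> \<iota>) I" "pull_ideal \<phi> J = extend_scalars \<phi> J"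
    using nested_hilbD(1,2)[OF N] F(1) by (simp_all add: pull_ideal_eq_extend_scalars[OF \<phi>] extend_scalars_twice[OF \<iota> \<phi>])
  obtain v where v: "basis_away pscale 1 UNIV I (Suc n) v"
    using univ_familyD(2)[OF I] by (auto simp: free_quot_def)
  note v_ext = basis_extend_scalars[OF _ psc_subspace_ideal[OF idI] v]
  have comp: "base_change (\<phi> \<circ> \<iota>) h = base_change \<phi> (base_change \<iota> h)" for h
    using semilinear.zero[OF semilinear_hom[OF \<phi>]] semilinear.zero[OF semilinear_hom[OF \<iota>]]
    by (intro poly2_eqI) (simp add: coeff2_base_change)
  have "locally_free_quot pscale UNIV (extend_scalars \<phi> J) n"
  proof (rule locally_free_base_change[OF \<phi> subspace_extend_scalars F(2,3) _ _ F(5)])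
    show "basis_away pscale 1 UNIV (extend_scalars \<iota> I) (Suc n) (\<lambda>i. base_change \<iota> (v i))"
      using v_ext[OF \<iota>] by (simp add: extend_scalars_UNIV[OF \<iota>])
    show "basis_away pscale 1 UNIV (extend_scalars \<phi> (extend_scalars \<iota> I)) (Suc n) (\<lambda>i. base_change \<phi> (base_change \<iota> (v i)))"
      using v_ext[OF \<phi>\<iota>] by (simp add: extend_scalars_UNIV[OF \<phi>\<iota>] extend_scalars_twice[OF \<iota> \<phi>] comp)
  qed
  then show "(pull_ideal \<phi> I', pull_ideal \<phi> J) \<in> fibre_rho (\<phi> \<circ> \<iota>) n I p"
    unfolding mem_fibre_rho_iff[OF I \<phi>\<iota>] pull
    using extend_scalars_mono[OF F(3), of \<phi>] extend_scalars_mono[OF F(4), of \<phi>] by (simp add: extend_scalars_twice[OF \<iota> \<phi>])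
  let ?L = "soc_line \<iota> I p (I', J)"
  have L: "?L \<in> proj_lines \<iota> pscale ?E I"
    using bij_soc_line[OF I \<iota>] IJ by (meson bij_betwE)
  then have rel: "tensor_rel \<iota> pscale ?E I \<subseteq> ?L" and free: "?L \<subseteq> free_on ?E"
    unfolding proj_lines_def by blast+
  have "pull_sub \<phi> ?L = soc_line (\<phi> \<circ> \<iota>) I p (extend_scalars (\<phi> \<circ> \<iota>) I, tensor_eval (\<phi> \<circ> \<iota>) ` pull_sub \<phi> ?L)"
    by (rule proj_line_is_soc_line[OF I \<phi>\<iota> _ tensor_rel_subset_pull_sub[OF \<phi> rel]
          pull_sub_subset_free_on[OF \<phi> free]]) (simp add: pull_sub_def)
  then show "soc_line (\<phi> \<circ> \<iota>) I p (pull_ideal \<phi> I', pull_ideal \<phi> J) = pull_sub \<phi> ?L"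
    by (simp add: pull tensor_eval_pull_sub[OF \<iota> \<phi>] tensor_eval_soc_line[OF F(4)])
qed

theorem proposition5p6:
  fixes n :: nat
    and I :: "complex poly poly set"
    and p :: "complex \<times> complex"
    and \<iota> :: "complex \<Rightarrow> 'b::comm_ring_1"
  assumes "(I, p) \<in> univ_family (Suc n)"
    and "unital_ring_hom \<iota>"
  shows "bij_betw (soc_line \<iota> I p) (fibre_rho \<iota> n I p) (proj_lines \<iota> pscale (soc_num I p) I) \<and>
    (\<forall>(\<iota>' :: complex \<Rightarrow> 'c::comm_ring_1) \<phi>.
       unital_ring_hom \<iota>' \<and> unital_ring_hom \<phi> \<and> \<phi> \<circ> \<iota> = \<iota>' \<longrightarrow>
       (\<forall>z \<in> fibre_rho \<iota> n I p.
          map_prod (pull_ideal \<phi>) (pull_ideal \<phi>) z \<in> fibre_rho \<iota>' n I p \<and>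
          soc_line \<iota>' I p (map_prod (pull_ideal \<phi>) (pull_ideal \<phi>) z) = pull_sub \<phi> (soc_line \<iota> I p z)))"
proof (intro conjI allI impI ballI)
  show "bij_betw (soc_line \<iota> I p) (fibre_rho \<iota> n I p) (proj_lines \<iota> pscale (soc_num I p) I)"
    by (rule bij_soc_line[OF assms])
next
  fix \<iota>' :: "complex \<Rightarrow> 'c" and \<phi> z
  assume hom: "unital_ring_hom \<iota>' \<and> unital_ring_hom \<phi> \<and> \<phi> \<circ> \<iota> = \<iota>'" and z: "z \<in> fibre_rho \<iota> n I p"
  obtain I' J where IJ: "z = (I', J)" by fastforce
  from hom have "unital_ring_hom \<phi>" "unital_ring_hom (\<phi> \<circ> \<iota>)" and \<iota>': "\<iota>' = \<phi> \<circ> \<iota>" by auto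
  note base_change = fibre_rho_base_change[OF assms this(1,2) z[unfolded IJ]]
  show "map_prod (pull_ideal \<phi>) (pull_ideal \<phi>) z \<in> fibre_rho \<iota>' n I p"
    unfolding IJ \<iota>' map_prod_simp by (rule base_change)
  show "soc_line \<iota>' I p (map_prod (pull_ideal \<phi>) (pull_ideal \<phi>) z) = pull_sub \<phi> (soc_line \<iota> I p z)"
    unfolding IJ \<iota>' map_prod_simp by (rule base_change)
qed

end
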